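(* Let $(I,\mathcal{E},g)$ be a percolation Markov decision process (PMDP) on $\mathbb{Z}^d$ and let $z\in\mathbb{Z}^d$. Then the sequence of $n$-stage values $v_n(z)$ converges $\mathbb{P}$-almost surely, as $n\to\infty$, to a limit $v_\infty(z)$. Moreover, $$v_\infty(z)=\begin{cases} g(z,0) & \text{if } I=\{0\},\\ M & \text{if the PMDP is controllable,}\end{cases}$$ where $M$ denotes the essential supremum of the (common) payoff distribution of $g$.
   Context: A PMDP on $\mathbb{Z}^d$ is a tuple $(I,\mathcal{E},g)$ where $I\subset\mathbb{Z}^d$ is a non-empty finite set (the action set), $\mathcal{E}=(\Omega,\mathscr{F},\mathbb{P})$ is a probability space, and $g=\{\omega\mapsto g_\omega(z,i)\}_{(z,i)\in\mathbb{Z}^d\times I}$ is a collection of uniformly bounded, i.i.d. real-valued random variables on $\Omega$. Let $\mathcal{F}_{\mathrm{all}}=\sigma(\{\omega\mapsto g_\omega(z,i): z\in\mathbb{Z}^d,i\in I\})$. A strategy is a sequence $\sigma=(\sigma_m)_{m\ge1}$ of mappings $\sigma_m:\Omega\times\mathbb{Z}^d\to I$, each measurable with respect to $\mathcal{F}_{\mathrm{all}}\otimes\mathcal{P}(\mathbb{Z}^d)$; $\Sigma$ is the set of strategies. Given an initial state $z$ and $\omega$, $\sigma$ induces the play $z_1=z$, $i_m=\sigma_m(\omega,z)$, $z_{m+1}=z_m+i_m$ for $m\ge1$. The $n$-stage payoff is $\gamma_n^\omega(z,\sigma)=\frac1n\sum_{m=1}^n g_\omega(z_m,i_m)$ and the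 $n$-stage value is $v_n^\omega(z)=\max_{\sigma\in\Sigma}\gamma_n^\omega(z,\sigma)$; $v_n(z)$ denotes the random variable $\omega\mapsto v_n^\omega(z)$. The PMDP is called trivial if $I=\{0\}$, oriented if $0\notin\operatorname{conv}(I)$, and controllable if $0\in\operatorname{conv}(I)$ and $I\ne\{0\}$. *)

theory Defs
  imports "HOL-Probability.Probability"
begin

text \<open>A percolation Markov decision process on \<open>\<int>\<^sup>d\<close>, modelled as the type \<open>int ^ 'd\<close>. The payoff
  \<open>g\<^sub>\<omega>(z, i)\<close> is written \<open>g \<omega> z i\<close>; only its values for \<open>\<omega> \<in> space P\<close> and \<open>i \<in> I\<close> matter.\<close>

locale PMDP = prob_space P
  for P :: "'w measure"
    and I :: "(int ^ 'd) set"
    and g :: "'w \<Rightarrow> int ^ 'd \<Rightarrow> int ^ 'd \<Rightarrow> real" +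
  assumes finite_actions: "finite I"
    and nonempty_actions: "I \<noteq> {}"
    and bounded_payoffs: "\<exists>C. \<forall>\<omega>\<in>space P. \<forall>z. \<forall>i\<in>I. \<bar>g \<omega> z i\<bar> \<le> C"
    and indep_payoffs: "indep_vars (\<lambda>_. borel) (\<lambda>(z, i) \<omega>. g \<omega> z i) (UNIV \<times> I)"
    and ident_payoffs: "\<And>z z' i i'. i \<in> I \<Longrightarrow> i' \<in> I \<Longrightarrow>
      distr P borel (\<lambda>\<omega>. g \<omega> z i) = distr P borel (\<lambda>\<omega>. g \<omega> z' i')"

definition F_all :: "'w measure \<Rightarrow> (int ^ 'd) set \<Rightarrow> ('w \<Rightarrow> int ^ 'd \<Rightarrow> int ^ 'd \<Rightarrow> real) \<Rightarrow> 'w measure"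
  where "F_all P I g = sigma (space P)
    {(\<lambda>\<omega>. g \<omega> z i) -` B \<inter> space P | z i B. i \<in> I \<and> B \<in> sets borel}"

text \<open>Stages are numbered from 1, so the entry \<open>\<sigma> 0\<close> of a strategy is irrelevant.\<close>

definition strategies ::
  "'w measure \<Rightarrow> (int ^ 'd) set \<Rightarrow> ('w \<Rightarrow> int ^ 'd \<Rightarrow> int ^ 'd \<Rightarrow> real)
    \<Rightarrow> (nat \<Rightarrow> 'w \<Rightarrow> int ^ 'd \<Rightarrow> int ^ 'd) set"
  where "strategies P I g =
    {\<sigma>. \<forall>m\<ge>1. (\<lambda>(\<omega>, z). \<sigma> m \<omega> z) \<in> F_all P I g \<Otimes>\<^sub>M count_space UNIV \<rightarrow>\<^sub>M count_space I}"

text \<open>The state \<open>z\<^sub>m\<close> of the play; \<open>z\<close> is the initial state, and the action at stage \<open>m\<close> is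
  \<open>i\<^sub>m = \<sigma>\<^sub>m(\<omega>, z)\<close>. Thus \<open>z\<^sub>1 = z\<close>; the value at index 0 is a dummy.\<close>

primrec state :: "(nat \<Rightarrow> 'w \<Rightarrow> int ^ 'd \<Rightarrow> int ^ 'd) \<Rightarrow> 'w \<Rightarrow> int ^ 'd \<Rightarrow> nat \<Rightarrow> int ^ 'd"
  where
    "state \<sigma> \<omega> z 0 = z"
  | "state \<sigma> \<omega> z (Suc m) = (if m = 0 then z else state \<sigma> \<omega> z m + \<sigma> m \<omega> z)"

definition stage_payoff ::
  "('w \<Rightarrow> int ^ 'd \<Rightarrow> int ^ 'd \<Rightarrow> real) \<Rightarrow> nat \<Rightarrow> 'w \<Rightarrow> int ^ 'd
    \<Rightarrow> (nat \<Rightarrow> 'w \<Rightarrow> int ^ 'd \<Rightarrow> int ^ 'd) \<Rightarrow> real"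
  where "stage_payoff g n \<omega> z \<sigma> =
    (1 / real n) * (\<Sum>m = 1..n. g \<omega> (state \<sigma> \<omega> z m) (\<sigma> m \<omega> z))"

text \<open>For \<open>\<omega> \<in> space P\<close> the maximum is over a finite nonempty set; see below.\<close>

definition stage_value ::
  "'w measure \<Rightarrow> (int ^ 'd) set \<Rightarrow> ('w \<Rightarrow> int ^ 'd \<Rightarrow> int ^ 'd \<Rightarrow> real)
    \<Rightarrow> nat \<Rightarrow> int ^ 'd \<Rightarrow> 'w \<Rightarrow> real"
  where "stage_value P I g n z \<omega> = Max (stage_payoff g n \<omega> z ` strategies P I g)"

definition conv :: "(int ^ 'd) set \<Rightarrow> (real ^ 'd) set"
  where "conv I = convex hull ((\<lambda>i. \<chi> k. real_of_int (i $ k)) ` I)"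

definition controllable :: "(int ^ 'd) set \<Rightarrow> bool"
  where "controllable I \<longleftrightarrow> 0 \<in> conv I \<and> I \<noteq> {0}"

definition payoff_law ::
  "'w measure \<Rightarrow> (int ^ 'd) set \<Rightarrow> ('w \<Rightarrow> int ^ 'd \<Rightarrow> int ^ 'd \<Rightarrow> real) \<Rightarrow> real measure"
  where "payoff_law P I g = (THE \<mu>. \<forall>z. \<forall>i\<in>I. distr P borel (\<lambda>\<omega>. g \<omega> z i) = \<mu>)"

text \<open>The essential supremum of a law \<open>\<mu>\<close> on the reals is that of the identity under \<open>\<mu>\<close>; the
  library notion takes values in a complete linear order, hence the embedding into \<^typ>\<open>ereal\<close>.\<close>

definition payoff_esssup ::
  "'w measure \<Rightarrow> (int ^ 'd) set \<Rightarrow> ('w \<Rightarrow> int ^ 'd \<Rightarrow> int ^ 'd \<Rightarrow> real) \<Rightarrow> ereal"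
  where "payoff_esssup P I g = esssup (payoff_law P I g) ereal"

lemma (in PMDP) payoff_law_eq:
  assumes "i \<in> I"
  shows "payoff_law P I g = distr P borel (\<lambda>\<omega>. g \<omega> z i)"
  unfolding payoff_law_def
proof (rule the_equality)
  show "\<forall>z'. \<forall>i'\<in>I. distr P borel (\<lambda>\<omega>. g \<omega> z' i') = distr P borel (\<lambda>\<omega>. g \<omega> z i)"
    using assms by (intro allI ballI ident_payoffs)
next
  fix \<mu> assume "\<forall>z. \<forall>i\<in>I. distr P borel (\<lambda>\<omega>. g \<omega> z i) = \<mu>"
  then show "\<mu> = distr P borel (\<lambda>\<omega>. g \<omega> z i)"
    using assms by simp
qed

lemma strategy_in_actions:
  assumes "\<sigma> \<in> strategies P I g" "m \<ge> 1" "\<omega> \<in> space P"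
  shows "\<sigma> m \<omega> z \<in> I"
proof -
  have "(\<lambda>(\<omega>, z). \<sigma> m \<omega> z) \<in> F_all P I g \<Otimes>\<^sub>M count_space UNIV \<rightarrow>\<^sub>M count_space I"
    using assms by (simp add: strategies_def)
  moreover have "(\<omega>, z) \<in> space (F_all P I g \<Otimes>\<^sub>M count_space UNIV)"
    using assms by (simp add: F_all_def space_pair_measure space_measure_of_conv)
  ultimately show ?thesis
    by (auto dest: measurable_space)
qed

lemma (in PMDP) strategies_nonempty: "strategies P I g \<noteq> {}"
proof -
  obtain i where "i \<in> I"
    using nonempty_actions by blast
  then have "(\<lambda>_ _ _. i) \<in> strategies P I g"
    unfolding strategies_def case_prod_unfold by (intro CollectI allI impI measurable_const) simp
  then show ?thesis
    by blast
qed

lemma state_cong: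
  assumes "\<And>k. 1 \<le> k \<Longrightarrow> k < m \<Longrightarrow> \<sigma> k \<omega> z = \<tau> k \<omega> z"
  shows "state \<sigma> \<omega> z m = state \<tau> \<omega> z m"
  using assms by (induction m) auto

lemma (in PMDP) finite_stage_payoffs:
  assumes "\<omega> \<in> space P"
  shows "finite (stage_payoff g n \<omega> z ` strategies P I g)"
proof (rule finite_subset)
  let ?A = "PiE {1..n} (\<lambda>_. I)"
  let ?h = "\<lambda>a. stage_payoff g n \<omega> z (\<lambda>m _ _. a m)"
  show "finite (?h ` ?A)"
    using finite_actions by (intro finite_imageI finite_PiE) auto
  show "stage_payoff g n \<omega> z ` strategies P I g \<subseteq> ?h ` ?A"
  proof
    fix y assume "y \<in> stage_payoff g n \<omega> z ` strategies P I g"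
    then obtain \<sigma> where \<sigma>: "\<sigma> \<in> strategies P I g" and y: "y = stage_payoff g n \<omega> z \<sigma>"
      by blast
    let ?a = "restrict (\<lambda>m. \<sigma> m \<omega> z) {1..n}"
    have a: "?a \<in> ?A"
      by (rule restrict_PiE_iff[THEN iffD2]) (simp add: strategy_in_actions[OF \<sigma> _ assms])
    have h: "y = ?h ?a"
      unfolding y stage_payoff_def
    proof (intro arg_cong2[where f = "(*)"] sum.cong refl)
      fix m assume m: "m \<in> {1..n}"
      have "state \<sigma> \<omega> z m = state (\<lambda>m _ _. ?a m) \<omega> z m"
        using m by (intro state_cong) auto
      then show "g \<omega> (state \<sigma> \<omega> z m) (\<sigma> m \<omega> z) = g \<omega> (state (\<lambda>m _ _. ?a m) \<omega> z m) (?a m)"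
        using m by simp
    qed
    show "y \<in> ?h ` ?A"
      by (rule image_eqI[where f = ?h, OF h a])
  qed
qed

end

theory Submission
  imports Defs "HOL-Real_Asymp.Real_Asymp"
begin

text \<open>The stage value is \<open>1/n\<close> times the solution of the Bellman recursion for the total payoff, and
  there are two substantial cases.

  If \<open>0 \<notin> conv I\<close>, a linear functional that is bounded below by a positive constant on \<open>I\<close> splits
  the lattice into layers that every play meets at most once, and plays of length \<open>n\<close> meet \<open>O(n)\<close>
  layers. The bounded differences inequality with one coordinate per layer therefore bounds the
  probability of a deviation of order \<open>n\<^bsup>3/4\<^esup>\<close> from the mean by \<open>2 exp (- \<kappa> sqrt n)\<close>. A union bound over
  the polynomially many states reachable in \<open>jn\<close> steps makes the means additive up to
  \<open>O(n\<^bsup>3/4\<^esup>)\<close>, so that they converge after division by \<open>n\<close>; Borel--Cantelli transfers this to the values.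

  If \<open>0 \<in> conv I\<close>, simultaneous Diophantine approximation of the convex coefficients yields a closed
  walk with steps in \<open>I\<close>. Almost surely some translate of it within reach has all its payoffs above
  \<open>M - \<epsilon>\<close>, and the player can go there and circulate forever.\<close>

section \<open>The bounded differences inequality\<close>

text \<open>Induction on the set of layers. The coordinates of one layer are integrated out with the
  others held fixed; under this constraint \<open>f\<close> varies by at most \<open>c\<close>, so
  Hoeffding's lemma contributes a factor \<open>exp (l\<^sup>2 * c\<^sup>2 / 8)\<close>. The
  averaged function inherits the bound \<open>b\<close> and the oscillation hypothesis for the
  remaining layers. A whole layer, not a single coordinate, plays the role of one independent
  variable.\<close>

lemma bounded_differences_mgf:
  fixes f :: "('i \<Rightarrow> 'a) \<Rightarrow> real" and lay :: "'i \<Rightarrow> 'k"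
  assumes M: "\<And>i. prob_space (M i)" and "finite K" and "finite J" "lay ` J \<subseteq> K"
    and "f \<in> borel_measurable (PiM J M)"
    and "\<And>x. x \<in> space (PiM J M) \<Longrightarrow> \<bar>f x\<bar> \<le> b"
    and "\<And>k x y. k \<in> K \<Longrightarrow> x \<in> space (PiM J M) \<Longrightarrow> y \<in> space (PiM J M) \<Longrightarrow>
        (\<And>i. i \<in> J \<Longrightarrow> lay i \<noteq> k \<Longrightarrow> x i = y i) \<Longrightarrow> \<bar>f x - f y\<bar> \<le> c"
    and l: "l > 0"
  shows "(\<integral>\<^sup>+x. exp (l * (f x - (\<integral>y. f y \<partial>PiM J M))) \<partial>PiM J M)
    \<le> ennreal (exp (l\<^sup>2 * c\<^sup>2 * card K / 8))"
  using assms(2-7)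
proof (induction K arbitrary: J f rule: finite_induct)
  case empty
  then have [simp]: "J = {}" by auto
  interpret P0: prob_space "PiM {} M" by (rule prob_space_PiM) (rule M)
  have "(\<integral>y. f y \<partial>PiM {} M) = (\<integral>y. f (\<lambda>_. undefined) \<partial>PiM {} M)"
    by (rule Bochner_Integration.integral_cong) (auto simp: space_PiM_empty)
  also have "\<dots> = f (\<lambda>_. undefined)"
    by (simp add: P0.prob_space)
  finally have "(\<integral>\<^sup>+x. exp (l * (f x - (\<integral>y. f y \<partial>PiM J M))) \<partial>PiM J M) = (\<integral>\<^sup>+x. 1 \<partial>PiM {} M)"
    unfolding \<open>J = {}\<close> by (intro nn_integral_cong) (auto simp: space_PiM_empty)
  then show ?case
    by (simp add: P0.emeasure_space_1)
next
  case (insert k F)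
  define J1 where "J1 = {i\<in>J. lay i \<noteq> k}"
  define B where "B = {i\<in>J. lay i = k}"
  have J: "J = J1 \<union> B" and disj: "J1 \<inter> B = {}" and fin: "finite J1" "finite B"
    using insert.prems(1) by (auto simp: J1_def B_def)
  interpret product_prob_space M UNIV by (rule product_prob_spaceI) (rule M)
  interpret PJ: prob_space "PiM J M" by (rule prob_space_PiM) (rule M)
  interpret P1: prob_space "PiM J1 M" by (rule prob_space_PiM) (rule M)
  interpret PB: prob_space "PiM B M" by (rule prob_space_PiM) (rule M)
  note [measurable] = insert.prems(3)
  note bd = insert.prems(4)
  \<comment> \<open>\<open>h\<close> is the conditional expectation of \<open>f\<close> given the
    coordinates outside layer \<open>k\<close>.\<close>
  define h where "h x = (\<integral>y. f (merge J1 B (x, y)) \<partial>PiM B M)" for x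
  have mrg [measurable]: "merge J1 B \<in> PiM J1 M \<Otimes>\<^sub>M PiM B M \<rightarrow>\<^sub>M PiM J M"
    unfolding J by (rule measurable_merge)
  have msp: "merge J1 B (x, y) \<in> space (PiM J M)"
    if "x \<in> space (PiM J1 M)" "y \<in> space (PiM B M)" for x y
    using that by (intro measurable_space[OF mrg]) (simp add: space_pair_measure)
  have fxm [measurable]: "(\<lambda>y. f (merge J1 B (x, y))) \<in> borel_measurable (PiM B M)"
    if "x \<in> space (PiM J1 M)" for x
    using that by measurable
  have fint: "integrable (PiM B M) (\<lambda>y. f (merge J1 B (x, y)))"
    if "x \<in> space (PiM J1 M)" for x
    using that by (intro PB.integrable_const_bound[where B = b] fxm) (auto intro!: bd msp)
  have hm [measurable]: "h \<in> borel_measurable (PiM J1 M)"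
    unfolding h_def by measurable
  have fi: "integrable (PiM J M) f"
    by (intro PJ.integrable_const_bound[where B = b]) (auto intro!: bd)
  have Eh: "(\<integral>x. h x \<partial>PiM J1 M) = (\<integral>x. f x \<partial>PiM J M)"
    unfolding h_def using fi unfolding J by (subst product_integral_fold[OF disj fin]) auto
  have hb: "\<bar>h x\<bar> \<le> b" if x: "x \<in> space (PiM J1 M)" for x
  proof -
    have bd': "\<bar>f (merge J1 B (x, y))\<bar> \<le> b" if "y \<in> space (PiM B M)" for y
      using x that by (intro bd msp)
    have "h x \<le> b" "- b \<le> h x"
      unfolding h_def using bd'
      by (auto intro!: PB.integral_le_const PB.integral_ge_const fint x AE_I2 simp: abs_le_iff)
         (smt (verit) bd')
    then show ?thesis by simp
  qed
  have hosc: "\<bar>h x - h y\<bar> \<le> c" if k': "k' \<in> F" and xy: "x \<in> space (PiM J1 M)" "y \<in> space (PiM J1 M)"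
    and ag: "\<And>i. i \<in> J1 \<Longrightarrow> lay i \<noteq> k' \<Longrightarrow> x i = y i" for k' x y
  proof -
    have o: "\<bar>f (merge J1 B (x, u)) - f (merge J1 B (y, u))\<bar> \<le> c" if "u \<in> space (PiM B M)" for u
      using that k' xy ag by (intro insert.prems(5)[of k'] msp) (auto simp: merge_def J)
    have d: "h x - h y = (\<integral>u. f (merge J1 B (x, u)) - f (merge J1 B (y, u)) \<partial>PiM B M)"
      unfolding h_def by (rule Bochner_Integration.integral_diff[symmetric]) (intro fint xy)+
    have "h x - h y \<le> c"
      unfolding d using o
      by (intro PB.integral_le_const AE_I2 Bochner_Integration.integrable_diff fint xy) (auto simp: abs_le_iff)
    moreover have "- c \<le> h x - h y"
      unfolding d using o
      by (intro PB.integral_ge_const AE_I2 Bochner_Integration.integrable_diff fint xy) (smt (verit))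
    ultimately show ?thesis by simp
  qed
  have inner: "(\<integral>\<^sup>+y. exp (l * (f (merge J1 B (x, y)) - h x)) \<partial>PiM B M) \<le> ennreal (exp (l\<^sup>2 * c\<^sup>2 / 8))"
    if x: "x \<in> space (PiM J1 M)" for x
  proof -
    \<comment> \<open>Hoeffding's lemma asks for an explicit interval. The values of the section
      differ by at most \<open>c\<close>, so they lie between their infimum and that infimum plus
      \<open>c\<close>.\<close>
    define R where "R = (\<lambda>y. f (merge J1 B (x, y))) ` space (PiM B M)"
    have o: "\<bar>f (merge J1 B (x, u)) - f (merge J1 B (x, v))\<bar> \<le> c"
      if "u \<in> space (PiM B M)" "v \<in> space (PiM B M)" for u v
      using that x by (intro insert.prems(5)[of k] msp) (auto simp: merge_def J1_def)
    have bb: "bdd_below R"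
      unfolding R_def using bd msp[OF x] by (intro bdd_belowI2[where m = "-b"]) (smt (verit))
    have ne: "R \<noteq> {}" using PB.not_empty by (auto simp: R_def)
    have rng: "f (merge J1 B (x, u)) \<in> {Inf R..Inf R + c}" if u: "u \<in> space (PiM B M)" for u
    proof -
      have "Inf R \<le> f (merge J1 B (x, u))"
        using u by (intro cInf_lower bb) (auto simp: R_def)
      moreover have "f (merge J1 B (x, u)) - c \<le> Inf R"
      proof (rule cInf_greatest[OF ne])
        fix r assume "r \<in> R"
        then obtain v where "v \<in> space (PiM B M)" "r = f (merge J1 B (x, v))" by (auto simp: R_def)
        then show "f (merge J1 B (x, u)) - c \<le> r" using o[OF u, of v] by (auto simp: abs_le_iff)
      qed
      ultimately show ?thesis by simp
    qed
    interpret interval_bounded_random_variable "PiM B M" "\<lambda>y. f (merge J1 B (x, y))" "Inf R" "Inf R + c"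
      using rng x by unfold_locales auto
    show ?thesis
      using Hoeffdings_lemma_nn_integral[OF l] by (simp add: h_def)
  qed
  have "(\<integral>\<^sup>+x. exp (l * (f x - (\<integral>y. f y \<partial>PiM J M))) \<partial>PiM J M)
    = (\<integral>\<^sup>+x. \<integral>\<^sup>+y. exp (l * (f (merge J1 B (x, y)) - (\<integral>y. f y \<partial>PiM J M))) \<partial>PiM B M \<partial>PiM J1 M)"
    unfolding J by (rule product_nn_integral_fold[OF disj fin]) (use insert.prems(3) in \<open>simp add: J\<close>)
  \<comment> \<open>The deviation splits as \<open>f - E f = (h - E f) + (f - h)\<close>, and the
    first summand does not depend on the inner variable.\<close>
  also have "\<dots> = (\<integral>\<^sup>+x. \<integral>\<^sup>+y. ennreal (exp (l * (h x - (\<integral>y. f y \<partial>PiM J M))))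
      * ennreal (exp (l * (f (merge J1 B (x, y)) - h x))) \<partial>PiM B M \<partial>PiM J1 M)"
    by (intro nn_integral_cong)
       (auto simp: ennreal_mult[symmetric] exp_add[symmetric] algebra_simps)
  also have "\<dots> = (\<integral>\<^sup>+x. ennreal (exp (l * (h x - (\<integral>y. f y \<partial>PiM J M))))
      * (\<integral>\<^sup>+y. ennreal (exp (l * (f (merge J1 B (x, y)) - h x))) \<partial>PiM B M) \<partial>PiM J1 M)"
    by (intro nn_integral_cong nn_integral_cmult) (auto intro!: measurable_compose[OF borel_measurable_diff[OF fxm]])
  also have "\<dots> \<le> (\<integral>\<^sup>+x. ennreal (exp (l * (h x - (\<integral>y. f y \<partial>PiM J M))))
      * ennreal (exp (l\<^sup>2 * c\<^sup>2 / 8)) \<partial>PiM J1 M)"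
    by (intro nn_integral_mono mult_left_mono inner) auto
  also have "\<dots> = (\<integral>\<^sup>+x. ennreal (exp (l * (h x - (\<integral>y. h y \<partial>PiM J1 M)))) \<partial>PiM J1 M)
      * ennreal (exp (l\<^sup>2 * c\<^sup>2 / 8))"
    unfolding Eh by (intro nn_integral_multc) measurable
  also have "\<dots> \<le> ennreal (exp (l\<^sup>2 * c\<^sup>2 * card F / 8)) * ennreal (exp (l\<^sup>2 * c\<^sup>2 / 8))"
  proof (intro mult_right_mono insert.IH hm hb hosc fin(1))
    show "lay ` J1 \<subseteq> F" using insert.prems(2) by (auto simp: J1_def)
  qed auto
  also have "\<dots> = ennreal (exp (l\<^sup>2 * c\<^sup>2 * card (insert k F) / 8))"
    using insert.hyps by (simp add: ennreal_mult[symmetric] exp_add[symmetric] field_simps)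
  finally show ?case .
qed

lemma bounded_differences_tail_ge:
  fixes f :: "('i \<Rightarrow> 'a) \<Rightarrow> real" and lay :: "'i \<Rightarrow> 'k"
  assumes M: "\<And>i. prob_space (M i)" and K: "finite K" "K \<noteq> {}" and J: "finite J" "lay ` J \<subseteq> K"
    and f [measurable]: "f \<in> borel_measurable (PiM J M)"
    and bd: "\<And>x. x \<in> space (PiM J M) \<Longrightarrow> \<bar>f x\<bar> \<le> b"
    and osc: "\<And>k x y. k \<in> K \<Longrightarrow> x \<in> space (PiM J M) \<Longrightarrow> y \<in> space (PiM J M) \<Longrightarrow>
        (\<And>i. i \<in> J \<Longrightarrow> lay i \<noteq> k \<Longrightarrow> x i = y i) \<Longrightarrow> \<bar>f x - f y\<bar> \<le> c"
    and c: "c > 0" and t: "t > 0"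
  shows "measure (PiM J M) {x\<in>space (PiM J M). f x - (\<integral>y. f y \<partial>PiM J M) \<ge> t}
    \<le> exp (- 2 * t\<^sup>2 / (c\<^sup>2 * card K))"
proof -
  interpret PJ: prob_space "PiM J M" by (rule prob_space_PiM) (rule M)
  define d where "d = c\<^sup>2 * card K"
  have d: "d > 0" using c K by (simp add: d_def card_gt_0_iff)
  \<comment> \<open>This value minimises the Chernoff exponent
    \<open>- l * t + l\<^sup>2 * d / 8\<close>.\<close>
  define l where "l = 4 * t / d"
  have l: "l > 0" using t d by (simp add: l_def)
  let ?A = "space (PiM J M)" and ?E = "\<integral>y. f y \<partial>PiM J M"
  have "emeasure (PiM J M) {x\<in>?A. f x - ?E \<ge> t} \<le>
      ennreal (exp (- l * t)) * (\<integral>\<^sup>+x. ennreal (exp (l * (f x - ?E))) * indicator ?A x \<partial>PiM J M)"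
    by (intro Chernoff_ineq_nn_integral_ge l) auto
  also have "(\<integral>\<^sup>+x. ennreal (exp (l * (f x - ?E))) * indicator ?A x \<partial>PiM J M)
      = (\<integral>\<^sup>+x. ennreal (exp (l * (f x - ?E))) \<partial>PiM J M)"
    by (intro nn_integral_cong) simp
  also have "ennreal (exp (- l * t)) * \<dots> \<le> ennreal (exp (- l * t)) * ennreal (exp (l\<^sup>2 * c\<^sup>2 * card K / 8))"
    by (intro mult_left_mono bounded_differences_mgf[OF M K(1) J f bd osc l]) auto
  also have "\<dots> = ennreal (exp (- l * t + l\<^sup>2 * d / 8))"
    by (simp add: ennreal_mult[symmetric] exp_add[symmetric] d_def mult.assoc)
  also have "- l * t + l\<^sup>2 * d / 8 = - 2 * t\<^sup>2 / d"
    using d by (simp add: l_def field_simps power2_eq_square)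
  finally show ?thesis
    by (simp add: PJ.emeasure_eq_measure d_def)
qed

lemma bounded_differences_tail:
  fixes f :: "('i \<Rightarrow> 'a) \<Rightarrow> real" and lay :: "'i \<Rightarrow> 'k"
  assumes M: "\<And>i. prob_space (M i)" and K: "finite K" "K \<noteq> {}" and J: "finite J" "lay ` J \<subseteq> K"
    and f [measurable]: "f \<in> borel_measurable (PiM J M)"
    and bd: "\<And>x. x \<in> space (PiM J M) \<Longrightarrow> \<bar>f x\<bar> \<le> b"
    and osc: "\<And>k x y. k \<in> K \<Longrightarrow> x \<in> space (PiM J M) \<Longrightarrow> y \<in> space (PiM J M) \<Longrightarrow>
        (\<And>i. i \<in> J \<Longrightarrow> lay i \<noteq> k \<Longrightarrow> x i = y i) \<Longrightarrow> \<bar>f x - f y\<bar> \<le> c"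
    and c: "c > 0" and t: "t > 0"
  shows "measure (PiM J M) {x\<in>space (PiM J M). \<bar>f x - (\<integral>y. f y \<partial>PiM J M)\<bar> \<ge> t}
    \<le> 2 * exp (- 2 * t\<^sup>2 / (c\<^sup>2 * card K))"
proof -
  interpret PJ: prob_space "PiM J M" by (rule prob_space_PiM) (rule M)
  let ?E = "\<integral>y. f y \<partial>PiM J M"
  have "{x\<in>space (PiM J M). \<bar>f x - ?E\<bar> \<ge> t}
      = {x\<in>space (PiM J M). f x - ?E \<ge> t} \<union> {x\<in>space (PiM J M). - f x - (\<integral>y. - f y \<partial>PiM J M) \<ge> t}"
    by (auto simp: abs_if)
  also have "PJ.prob \<dots> \<le> PJ.prob {x\<in>space (PiM J M). f x - ?E \<ge> t}
      + PJ.prob {x\<in>space (PiM J M). - f x - (\<integral>y. - f y \<partial>PiM J M) \<ge> t}"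
    by (intro measure_Un_le) measurable
  also have "\<dots> \<le> exp (- 2 * t\<^sup>2 / (c\<^sup>2 * card K)) + exp (- 2 * t\<^sup>2 / (c\<^sup>2 * card K))"
  proof (intro add_mono)
    show "PJ.prob {x\<in>space (PiM J M). f x - ?E \<ge> t} \<le> exp (- 2 * t\<^sup>2 / (c\<^sup>2 * card K))"
      by (rule bounded_differences_tail_ge[OF M K J f bd osc c t])
    show "PJ.prob {x\<in>space (PiM J M). - f x - (\<integral>y. - f y \<partial>PiM J M) \<ge> t} \<le> exp (- 2 * t\<^sup>2 / (c\<^sup>2 * card K))"
    proof (rule bounded_differences_tail_ge[OF M K J _ _ _ c t])
      fix k x y assume "k \<in> K" "x \<in> space (PiM J M)" "y \<in> space (PiM J M)"
        "\<And>i. i \<in> J \<Longrightarrow> lay i \<noteq> k \<Longrightarrow> x i = y i"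
      from osc[OF this] show "\<bar>- f x - - f y\<bar> \<le> c" by linarith
    qed (use bd in auto)
  qed
  finally show ?thesis by simp
qed

section \<open>The Bellman recursion\<close>

text \<open>The optimal total payoff over \<open>n\<close> stages in one fixed environment
  \<open>x\<close>. Without the factor \<open>1/n\<close> the recursion carries no weights, and
  probability enters only through the choice of \<open>x\<close>.\<close>

primrec total_value :: "'a::plus set \<Rightarrow> ('a \<Rightarrow> 'a \<Rightarrow> real) \<Rightarrow> nat \<Rightarrow> 'a \<Rightarrow> real" where
  "total_value I x 0 z = 0"
| "total_value I x (Suc n) z = Max ((\<lambda>i. x z i + total_value I x n (z + i)) ` I)"

declare total_value.simps(2) [simp del]

context
  fixes I :: "'a::ab_group_add set"
  assumes fin: "finite I" and ne: "I \<noteq> {}"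
begin

lemma total_value_step_le: "i \<in> I \<Longrightarrow> x z i + total_value I x n (z + i) \<le> total_value I x (Suc n) z"
  unfolding total_value.simps using fin by (intro Max_ge) auto

lemma total_value_attained:
  obtains i where "i \<in> I" "total_value I x (Suc n) z = x z i + total_value I x n (z + i)"
proof -
  have "total_value I x (Suc n) z \<in> (\<lambda>i. x z i + total_value I x n (z + i)) ` I"
    unfolding total_value.simps using fin ne by (intro Max_in) auto
  then show thesis using that by auto
qed

lemma total_value_le:
  assumes "\<And>i. i \<in> I \<Longrightarrow> x z i + total_value I x n (z + i) \<le> u"
  shows "total_value I x (Suc n) z \<le> u"
  using assms total_value_attained[of x n z] by metis

lemma total_value_upper:
  assumes "\<And>y i. i \<in> I \<Longrightarrow> x y i \<le> C"
  shows "total_value I x n z \<le> real n * C"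
proof (induction n arbitrary: z)
  case (Suc n)
  show ?case
  proof (rule total_value_le)
    fix i assume "i \<in> I"
    then show "x z i + total_value I x n (z + i) \<le> real (Suc n) * C"
      using Suc[of "z + i"] assms[of i z] by (simp add: algebra_simps)
  qed
qed simp

lemma total_value_lower:
  assumes "\<And>y i. i \<in> I \<Longrightarrow> C \<le> x y i"
  shows "real n * C \<le> total_value I x n z"
proof (induction n arbitrary: z)
  case (Suc n)
  obtain i where "i \<in> I" "total_value I x (Suc n) z = x z i + total_value I x n (z + i)"
    by (rule total_value_attained)
  then show ?case
    using Suc[of "z + i"] assms[of i z] by (simp add: algebra_simps)
qed simp

lemma total_value_abs_le:
  assumes "\<And>y i. i \<in> I \<Longrightarrow> \<bar>x y i\<bar> \<le> C"
  shows "\<bar>total_value I x n z\<bar> \<le> real n * C"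
proof -
  have "- C \<le> x y i" "x y i \<le> C" if "i \<in> I" for y i
    using assms[OF that, of y] by auto
  then show ?thesis
    using total_value_upper[of x C n z] total_value_lower[of "- C" x n z] by auto
qed

text \<open>Changing the initial state amounts to shifting the environment; this is how stationarity
  of the payoffs will be used.\<close>

lemma total_value_translate:
  "total_value I x n (y + z) = total_value I (\<lambda>u. x (u + z)) n y"
proof (induction n arbitrary: y)
  case (Suc n)
  show ?case
    unfolding total_value.simps
    by (intro arg_cong[where f = Max] image_cong) (simp_all add: Suc[symmetric] algebra_simps)
qed simp

lemma borel_measurable_total_value:
  assumes "\<And>y i. i \<in> I \<Longrightarrow> (\<lambda>w. h w y i) \<in> borel_measurable N"
  shows "(\<lambda>w. total_value I (h w) n z) \<in> borel_measurable N"
proof (induction n arbitrary: z)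
  case (Suc n)
  then show ?case
    unfolding total_value.simps using assms fin by (intro borel_measurable_Max borel_measurable_add) auto
qed simp

text \<open>The layer index increases strictly along a play, so a play that starts above layer
  \<open>k\<close> never sees the payoffs of that layer.\<close>

lemma total_value_cong_layer_gt:
  fixes lay :: "'a \<Rightarrow> 'k::linorder"
  assumes lay: "\<And>y i. i \<in> I \<Longrightarrow> lay y < lay (y + i)"
    and agree: "\<And>y i. i \<in> I \<Longrightarrow> lay y \<noteq> k \<Longrightarrow> x y i = x' y i"
    and "k < lay z"
  shows "total_value I x n z = total_value I x' n z"
  using \<open>k < lay z\<close>
proof (induction n arbitrary: z)
  case (Suc n)
  have "x z i + total_value I x n (z + i) = x' z i + total_value I x' n (z + i)" if "i \<in> I" for i
    using agree[OF that, of z] Suc.IH[of "z + i"] lay[OF that, of z] Suc.prems by auto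
  then show ?case
    unfolding total_value.simps by (intro arg_cong[where f = Max] image_cong) auto
qed simp

text \<open>Each layer is met at most once by a play, so changing one layer moves the value by at most
  the size of one payoff change.\<close>

lemma total_value_layer_le:
  fixes lay :: "'a \<Rightarrow> 'k::linorder"
  assumes lay: "\<And>y i. i \<in> I \<Longrightarrow> lay y < lay (y + i)"
    and agree: "\<And>y i. i \<in> I \<Longrightarrow> lay y \<noteq> k \<Longrightarrow> x y i = x' y i"
    and c: "\<And>y i. i \<in> I \<Longrightarrow> x y i \<le> x' y i + c" and "c \<ge> 0"
  shows "total_value I x n z \<le> total_value I x' n z + c"
proof (induction n arbitrary: z)
  case (Suc n)
  show ?case
  proof (rule total_value_le)
    fix i assume i: "i \<in> I"
    have "x z i + total_value I x n (z + i) \<le> x' z i + total_value I x' n (z + i) + c"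
    proof (cases "lay z = k")
      case True
      then have "k < lay (z + i)" using lay[OF i, of z] by simp
      from total_value_cong_layer_gt[OF lay agree this] show ?thesis
        using c[OF i, of z] by simp
    next
      case False
      then show ?thesis using agree[OF i] Suc[of "z + i"] by simp
    qed
    then show "x z i + total_value I x n (z + i) \<le> total_value I x' (Suc n) z + c"
      using total_value_step_le[OF i, of x' z n] by linarith
  qed
qed (use \<open>c \<ge> 0\<close> in simp)

text \<open>The remainder \<open>r\<close> serves the induction: a played prefix of \<open>n\<close>
  stages is completed optimally for \<open>r\<close> more stages, and each induction step moves one
  stage from the remainder to the prefix. The case \<open>r = 0\<close> says that no play beats the
  recursion.\<close>

lemma play_le_total_value:
  assumes "\<And>m. m \<ge> 1 \<Longrightarrow> a m \<in> I" "s 1 = z" "\<And>m. m \<ge> 1 \<Longrightarrow> s (Suc m) = s m + a m"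
  shows "(\<Sum>m=1..n. x (s m) (a m)) + total_value I x r (s (Suc n)) \<le> total_value I x (n + r) z"
proof (induction n arbitrary: r)
  case 0
  then show ?case using assms(2) by simp
next
  case (Suc n)
  have "x (s (Suc n)) (a (Suc n)) + total_value I x r (s (Suc (Suc n))) \<le> total_value I x (Suc r) (s (Suc n))"
    using total_value_step_le[of "a (Suc n)" x "s (Suc n)" r] assms(1)[of "Suc n"] assms(3)[of "Suc n"] by simp
  then show ?case using Suc[of "Suc r"] by simp
qed

lemma total_value_attained_by_play:
  "\<exists>a s. (\<forall>m. a m \<in> I) \<and> s 1 = z \<and> (\<forall>m\<ge>1. s (Suc m) = s m + a m) \<and>
    total_value I x n z = (\<Sum>m=1..n. x (s m) (a m))"
proof (induction n arbitrary: z)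
  case 0
  obtain i where "i \<in> I" using ne by auto
  \<comment> \<open>Starting the recursion at \<open>z - i\<close> puts the state \<open>z\<close>
    at index 1; index 0 is a dummy.\<close>
  then show ?case
    by (intro exI[of _ "\<lambda>_. i"] exI[of _ "rec_nat (z - i) (\<lambda>_ y. y + i)"]) auto
next
  case (Suc n)
  obtain i where i: "i \<in> I" "total_value I x (Suc n) z = x z i + total_value I x n (z + i)"
    by (rule total_value_attained)
  obtain a s where as: "\<And>m. a m \<in> I" "s 1 = z + i" "\<And>m. m \<ge> 1 \<Longrightarrow> s (Suc m) = s m + a m"
    "total_value I x n (z + i) = (\<Sum>m=1..n. x (s m) (a m))"
    using Suc[of "z + i"] by blast
  \<comment> \<open>The action \<open>i\<close> is put in front and the old play is delayed by one
    stage. Index 0 also receives \<open>i\<close>, because every entry of the action sequence has to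
    lie in \<open>I\<close>.\<close>
  define a' where "a' m = (if m \<le> 1 then i else a (m - 1))" for m
  define s' where "s' m = (if m \<le> 1 then z else s (m - 1))" for m
  have "\<forall>m. a' m \<in> I" "s' 1 = z"
    using as(1) i(1) by (simp_all add: a'_def s'_def)
  moreover have "s' (Suc m) = s' m + a' m" if "m \<ge> 1" for m
    using that as(2) as(3)[of "m - 1"] by (cases "m = 1") (auto simp: s'_def a'_def)
  moreover have "total_value I x (Suc n) z = (\<Sum>m=1..Suc n. x (s' m) (a' m))"
    unfolding i(2) as(4) One_nat_def sum.atLeast1_atMost_eq
    by (simp add: sum.lessThan_Suc_shift s'_def a'_def del: sum.lessThan_Suc)
  ultimately show ?case by blast
qed

end

text \<open>A strategy may depend on the whole environment, so the maximum can be computed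
  separately at each \<open>\<omega>\<close>, where it is a deterministic optimisation over
  plays.\<close>

lemma (in PMDP) stage_value_eq:
  assumes \<omega>: "\<omega> \<in> space P"
  shows "stage_value P I g n z \<omega> = total_value I (g \<omega>) n z / n"
  unfolding stage_value_def
proof (rule Max_eqI[OF finite_stage_payoffs[OF \<omega>]])
  fix y assume "y \<in> stage_payoff g n \<omega> z ` strategies P I g"
  then obtain \<sigma> where \<sigma>: "\<sigma> \<in> strategies P I g" "y = stage_payoff g n \<omega> z \<sigma>" by auto
  have "(\<Sum>m=1..n. g \<omega> (state \<sigma> \<omega> z m) (\<sigma> m \<omega> z)) \<le> total_value I (g \<omega>) n z"
    using play_le_total_value[OF finite_actions nonempty_actions, of "\<lambda>m. \<sigma> m \<omega> z" "state \<sigma> \<omega> z" z "g \<omega>" n 0]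
      strategy_in_actions[OF \<sigma>(1) _ \<omega>] by simp
  then show "y \<le> total_value I (g \<omega>) n z / n"
    unfolding \<sigma>(2) stage_payoff_def by (simp add: divide_right_mono)
next
  obtain a s where as: "\<And>m. a m \<in> I" "s 1 = z" "\<And>m. m \<ge> 1 \<Longrightarrow> s (Suc m) = s m + a m"
    "total_value I (g \<omega>) n z = (\<Sum>m=1..n. g \<omega> (s m) (a m))"
    using total_value_attained_by_play[OF finite_actions nonempty_actions, of z "g \<omega>" n] by blast
  \<comment> \<open>The optimal actions for this one \<open>\<omega>\<close> are prescribed
    everywhere on the probability space. The strategy is constant, so no measurable selection is
    involved.\<close>
  define \<sigma> :: "nat \<Rightarrow> 'w \<Rightarrow> int ^ 'd \<Rightarrow> int ^ 'd" where "\<sigma> = (\<lambda>m _ _. a m)"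
  have st: "state \<sigma> \<omega> z m = s m" if "m \<ge> 1" for m
    using that by (induction m rule: nat_induct_at_least) (use as(2,3) in \<open>auto simp: \<sigma>_def\<close>)
  have "\<sigma> \<in> strategies P I g"
    unfolding strategies_def case_prod_unfold \<sigma>_def
    by (intro CollectI allI impI measurable_const) (simp add: as(1))
  moreover have "total_value I (g \<omega>) n z / n = stage_payoff g n \<omega> z \<sigma>"
    unfolding stage_payoff_def as(4) using st by (simp add: \<sigma>_def)
  ultimately show "total_value I (g \<omega>) n z / n \<in> stage_payoff g n \<omega> z ` strategies P I g"
    by blast
qed

section \<open>The controllable case\<close>

text \<open>Let \<open>\<alpha>\<close> be convex coefficients representing 0. Dirichlet's theorem
  gives \<open>q > 0\<close> such that every \<open>q * \<alpha> i\<close> is within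
  \<open>1 / N\<close> of an integer \<open>r i\<close>. For large \<open>N\<close> the coordinates
  of the integer vector formed with the \<open>r i\<close> are smaller than 1 in absolute value,
  hence zero. In the same way \<open>r i > -1\<close> forces \<open>r i\<close> to be nonnegative,
  and the total stays positive because it is within less than 1 of \<open>q\<close>.\<close>

lemma closed_walk_multiplicities:
  fixes I :: "(int ^ 'd) set"
  assumes fin: "finite I" and zero: "0 \<in> conv I"
  obtains m :: "int ^ 'd \<Rightarrow> nat" where "(\<Sum>i\<in>I. m i) > 0" "\<And>k. (\<Sum>i\<in>I. int (m i) * i $ k) = 0"
proof -
  define f :: "int ^ 'd \<Rightarrow> real ^ 'd" where "f i = (\<chi> k. real_of_int (i $ k))" for i
  have inj: "inj_on f I" by (auto simp: inj_on_def f_def vec_eq_iff)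
  have "0 \<in> convex hull (f ` I)" using zero by (simp add: conv_def f_def[abs_def])
  then obtain u where u: "\<And>x. x \<in> f ` I \<Longrightarrow> 0 \<le> u x" "sum u (f ` I) = 1" "(\<Sum>x\<in>f ` I. u x *\<^sub>R x) = 0"
    using fin by (subst (asm) convex_hull_finite) auto
  define \<alpha> where "\<alpha> i = u (f i)" for i
  have \<alpha>0: "\<alpha> i \<ge> 0" if "i \<in> I" for i using u(1) that by (auto simp: \<alpha>_def)
  have \<alpha>1: "(\<Sum>i\<in>I. \<alpha> i) = 1" using u(2) by (simp add: sum.reindex[OF inj] \<alpha>_def)
  have \<alpha>s: "(\<Sum>i\<in>I. \<alpha> i * real_of_int (i $ k)) = 0" for k
  proof -
    have "(\<Sum>i\<in>I. \<alpha> i *\<^sub>R f i) = 0" using u(3) by (simp add: sum.reindex[OF inj] \<alpha>_def)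
    then have "(\<Sum>i\<in>I. \<alpha> i *\<^sub>R f i) $ k = 0" by simp
    then show ?thesis by (simp add: f_def)
  qed
  \<comment> \<open>\<open>S\<close> dominates both \<open>card I\<close> and, for each
    \<open>k\<close>, the sum of the absolute values of the \<open>k\<close>-th coordinates. Once
    \<open>N\<close> exceeds \<open>S\<close>, both accumulated rounding errors are below 1.\<close>
  define S where "S = (\<Sum>i\<in>I. 1 + (\<Sum>k\<in>UNIV. \<bar>i $ k\<bar>))"
  have S0: "S \<ge> 0" unfolding S_def by (intro sum_nonneg add_nonneg_nonneg) auto
  define N where "N = nat (S + 1)"
  have N: "N > 0" "real N > S" using S0 by (auto simp: N_def)
  obtain h where h: "bij_betw h {0..<card I} I" using ex_bij_betw_nat_finite[OF fin] by blast
  obtain q p where q: "0 < q" and qp: "\<And>j. j < card I \<Longrightarrow> \<bar>of_int q * \<alpha> (h j) - of_int (p j)\<bar> < 1 / N"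
    using Dirichlet_approx_simult[OF N(1), of "card I" "\<lambda>j. \<alpha> (h j)"] by metis
  \<comment> \<open>The approximation theorem indexes by numbers below \<open>card I\<close>;
    \<open>r\<close> carries its numerators back to the actions.\<close>
  define r where "r i = p (the_inv_into {0..<card I} h i)" for i
  have r: "\<bar>of_int q * \<alpha> i - of_int (r i)\<bar> < 1 / N" if i: "i \<in> I" for i
  proof -
    obtain j where j: "j < card I" "i = h j"
      using bij_betw_imp_surj_on[OF h] i by (metis imageE atLeastLessThan_iff)
    then have "the_inv_into {0..<card I} h i = j"
      using h by (auto simp: bij_betw_def intro!: the_inv_into_f_f)
    then show ?thesis using qp[OF j(1)] j by (simp add: r_def)
  qed
  have N1: "1 / real N \<le> 1" using N by simp
  have r0: "r i \<ge> 0" if "i \<in> I" for i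
  proof -
    have "of_int q * \<alpha> i \<ge> 0" using q \<alpha>0[OF that] by simp
    then have "real_of_int (r i) > -1" using r[OF that] N1 by linarith
    then show ?thesis by linarith
  qed
  have small: "(\<Sum>i\<in>I. c i / N) < 1" if "\<And>i. i \<in> I \<Longrightarrow> c i \<le> real_of_int (1 + (\<Sum>k\<in>UNIV. \<bar>i $ k\<bar>))" for c
  proof -
    have "(\<Sum>i\<in>I. c i / N) = (\<Sum>i\<in>I. c i) / N" by (simp add: sum_divide_distrib)
    also have "\<dots> \<le> real_of_int S / N"
      unfolding S_def of_int_sum using that by (intro divide_right_mono sum_mono) auto
    also have "\<dots> < 1" using N by simp
    finally show ?thesis .
  qed
  have rs: "(\<Sum>i\<in>I. r i * i $ k) = 0" for k
  proof -
    have "real_of_int (\<Sum>i\<in>I. r i * i $ k) = (\<Sum>i\<in>I. (of_int (r i) - of_int q * \<alpha> i) * of_int (i $ k)) + of_int q * (\<Sum>i\<in>I. \<alpha> i * of_int (i $ k))"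
      by (simp add: sum_distrib_left sum.distrib[symmetric] algebra_simps)
    also have "\<dots> = (\<Sum>i\<in>I. (of_int (r i) - of_int q * \<alpha> i) * of_int (i $ k))"
      by (simp add: \<alpha>s)
    also have "\<bar>\<dots>\<bar> \<le> (\<Sum>i\<in>I. \<bar>of_int (i $ k)\<bar> / N)"
    proof (rule order.trans[OF sum_abs sum_mono])
      fix i assume "i \<in> I"
      from r[OF this] show "\<bar>(of_int (r i) - of_int q * \<alpha> i) * of_int (i $ k)\<bar> \<le> \<bar>of_int (i $ k)\<bar> / N"
        using mult_right_mono[of "\<bar>of_int (r i) - of_int q * \<alpha> i\<bar>" "1 / N" "\<bar>of_int (i $ k)\<bar>"]
        by (simp add: abs_mult abs_minus_commute)
    qed
    also have "\<dots> < 1"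
    proof (rule small)
      fix i :: "int ^ 'd"
      have "\<bar>i $ k\<bar> \<le> (\<Sum>k\<in>UNIV. \<bar>i $ k\<bar>)" by (rule member_le_sum) auto
      then show "\<bar>real_of_int (i $ k)\<bar> \<le> real_of_int (1 + (\<Sum>k\<in>UNIV. \<bar>i $ k\<bar>))" by linarith
    qed
    finally show ?thesis by linarith
  qed
  have rpos: "(\<Sum>i\<in>I. r i) > 0"
  proof -
    have "real_of_int (\<Sum>i\<in>I. r i) = (\<Sum>i\<in>I. of_int (r i) - of_int q * \<alpha> i) + of_int q"
      using \<alpha>1 by (simp add: sum_subtractf sum_distrib_left[symmetric])
    moreover have "(\<Sum>i\<in>I. of_int (r i) - of_int q * \<alpha> i) \<ge> - (\<Sum>i\<in>I. 1 / real N)"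
      unfolding sum_negf[symmetric] using r by (intro sum_mono) (smt (verit))
    moreover have "(\<Sum>i\<in>I. 1 / real N) < 1"
      by (rule small) (simp add: sum_nonneg)
    ultimately have "real_of_int (\<Sum>i\<in>I. r i) > 0" using q by linarith
    then show ?thesis by linarith
  qed
  show thesis
  proof
    show "(\<Sum>i\<in>I. nat (r i)) > 0"
    proof -
      have "int (\<Sum>i\<in>I. nat (r i)) = (\<Sum>i\<in>I. r i)" using r0 by simp
      then show ?thesis using rpos by linarith
    qed
    show "(\<Sum>i\<in>I. int (nat (r i)) * i $ k) = 0" for k
      using rs[of k] r0 by simp
  qed
qed

text \<open>Repeating each action according to its multiplicity gives the walk. The order is
  irrelevant since only the sum has to vanish.\<close>

lemma closed_walk_exists:
  fixes I :: "(int ^ 'd) set"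
  assumes fin: "finite I" and zero: "0 \<in> conv I"
  obtains xs where "set xs \<subseteq> I" "xs \<noteq> []" "sum_list xs = 0"
proof -
  obtain m where m: "(\<Sum>i\<in>I. m i) > 0" "\<And>k. (\<Sum>i\<in>I. int (m i) * i $ k) = 0"
    using closed_walk_multiplicities[OF assms] by blast
  obtain ys where ys: "set ys = I" "distinct ys" using finite_distinct_list[OF fin] by blast
  define xs where "xs = concat (map (\<lambda>i. replicate (m i) i) ys)"
  have nth: "sum_list zs $ k = (\<Sum>i\<leftarrow>zs. i $ k)" for zs :: "(int ^ 'd) list" and k
    by (induction zs) auto
  have rep: "(\<Sum>i\<leftarrow>concat (map (\<lambda>i. replicate (m i) i) zs). i $ k) = (\<Sum>i\<leftarrow>zs. int (m i) * i $ k)" for zs k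
    by (induction zs) (auto simp: sum_list_replicate)
  have "sum_list xs = 0"
    unfolding vec_eq_iff nth xs_def rep using m(2) ys by (simp add: sum_list_distinct_conv_sum_set)
  moreover have "length xs = (\<Sum>i\<in>I. m i)"
    unfolding xs_def using ys by (simp add: length_concat comp_def sum_list_distinct_conv_sum_set)
  then have "xs \<noteq> []" using m(1) by auto
  moreover have "set xs \<subseteq> I" using ys by (auto simp: xs_def)
  ultimately show thesis using that by blast
qed

section \<open>Deterministic lower bounds on the total value\<close>

text \<open>Remaining in \<open>G\<close> forever is a feasible play. \<open>G\<close> will be the
  vertex set of a closed walk whose payoffs are all high.\<close>

lemma total_value_ge_trap:
  fixes I :: "'a::ab_group_add set"
  assumes fin: "finite I" "I \<noteq> {}"
    and G: "\<And>y. y \<in> G \<Longrightarrow> \<exists>i\<in>I. c \<le> x y i \<and> y + i \<in> G" and "z \<in> G"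
  shows "real n * c \<le> total_value I x n z"
  using \<open>z \<in> G\<close>
proof (induction n arbitrary: z)
  case (Suc n)
  then obtain i where i: "i \<in> I" "c \<le> x z i" "z + i \<in> G" using G by blast
  show ?case
    using total_value_step_le[OF fin i(1), of x z n] Suc.IH[OF i(3)] i(2) by (simp add: algebra_simps)
qed simp

text \<open>Reaching a distant state by repeating one action costs at most \<open>C\<close> per
  stage.\<close>

lemma total_value_ge_walk:
  fixes I :: "(int ^ 'd) set"
  assumes fin: "finite I" and i: "i \<in> I" and C: "\<And>y i. i \<in> I \<Longrightarrow> - C \<le> x y i"
  shows "total_value I x n (z + of_nat K * i) - real K * C \<le> total_value I x (n + K) z"
proof (induction K arbitrary: z)
  case (Suc K)
  have "total_value I x n ((z + i) + of_nat K * i) - real K * C \<le> total_value I x (n + K) (z + i)"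
    by (rule Suc)
  moreover have "x z i + total_value I x (n + K) (z + i) \<le> total_value I x (Suc (n + K)) z"
    using fin i by (intro total_value_step_le) auto
  ultimately show ?case using C[OF i, of z] by (simp add: algebra_simps)
qed simp

text \<open>The length \<open>K\<close> of the approach does not depend on \<open>n\<close>, so its
  cost vanishes after division by \<open>n\<close>.\<close>

lemma eventually_total_value_gt:
  fixes I :: "(int ^ 'd) set"
  assumes fin: "finite I" and i: "i \<in> I" and C: "\<And>y i. i \<in> I \<Longrightarrow> - C \<le> x y i"
    and c: "\<And>n. real n * c \<le> total_value I x n (z + of_nat K * i)" and "c' < c"
  shows "\<forall>\<^sub>F n in sequentially. c' < total_value I x n z / n"
proof -
  have "(\<lambda>n. ((real n - real K) * c - real K * C) / n) \<longlonglongrightarrow> c"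
    by real_asymp
  then have "\<forall>\<^sub>F n in sequentially. c' < ((real n - real K) * c - real K * C) / n"
    using \<open>c' < c\<close> by (rule order_tendstoD)
  then show ?thesis
    using eventually_ge_at_top[of K]
  proof eventually_elim
    case (elim n)
    have "(real n - real K) * c - real K * C \<le> total_value I x n z"
      using total_value_ge_walk[OF fin i, of C x "n - K" z K, OF C] c[of "n - K"] elim(2)
      by (simp add: of_nat_diff)
    then show ?case using elim(1) by (meson divide_right_mono le_less_trans not_le of_nat_0_le_iff)
  qed
qed

section \<open>Payoff law, independence and the almost sure limit in the controllable case\<close>

context PMDP begin

lemma borel_measurable_payoff [measurable (raw)]:
  assumes "i \<in> I" shows "(\<lambda>\<omega>. g \<omega> y i) \<in> borel_measurable P"
proof -
  have "\<forall>e\<in>UNIV \<times> I. (\<lambda>\<omega>. case e of (z, i) \<Rightarrow> g \<omega> z i) \<in> borel_measurable P"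
    using indep_payoffs unfolding indep_vars_def2 by (auto split: prod.splits)
  then show ?thesis using assms by auto
qed

lemma payoff_bound:
  obtains C where "C > 0" "\<And>\<omega> y i. \<omega> \<in> space P \<Longrightarrow> i \<in> I \<Longrightarrow> \<bar>g \<omega> y i\<bar> \<le> C"
proof -
  obtain C where "\<forall>\<omega>\<in>space P. \<forall>z. \<forall>i\<in>I. \<bar>g \<omega> z i\<bar> \<le> C" using bounded_payoffs by blast
  then show thesis by (intro that[of "max C 1"]) (auto simp: max_def intro: order.trans)
qed

lemma prob_payoff_eq:
  assumes "i \<in> I" "B \<in> sets borel"
  shows "prob {\<omega>\<in>space P. g \<omega> y i \<in> B} = measure (payoff_law P I g) B"
  unfolding payoff_law_eq[OF assms(1), of y] using assms
  by (subst measure_distr) (auto intro!: borel_measurable_payoff arg_cong[where f = prob])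

text \<open>Boundedness of the payoffs makes the extended real supremum finite. The other two
  conclusions are its two working properties: it bounds payoffs almost surely, and every smaller
  threshold is exceeded with positive probability.\<close>

lemma payoff_esssup_real:
  obtains M where "payoff_esssup P I g = ereal M"
    "\<And>y i. i \<in> I \<Longrightarrow> AE \<omega> in P. g \<omega> y i \<le> M"
    "\<And>c. c < M \<Longrightarrow> measure (payoff_law P I g) {c<..} > 0"
proof -
  obtain C where C: "C > 0" "\<And>\<omega> y i. \<omega> \<in> space P \<Longrightarrow> i \<in> I \<Longrightarrow> \<bar>g \<omega> y i\<bar> \<le> C"
    by (rule payoff_bound) blast
  obtain i0 where i0: "i0 \<in> I" using nonempty_actions by blast
  let ?\<mu> = "payoff_law P I g"
  have \<mu>: "?\<mu> = distr P borel (\<lambda>\<omega>. g \<omega> y i)" if "i \<in> I" for y i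
    using payoff_law_eq[OF that] .
  interpret \<mu>: prob_space ?\<mu>
    unfolding \<mu>[OF i0, of 0] by (intro prob_space_distr borel_measurable_payoff i0)
  have sets: "sets ?\<mu> = sets borel" using \<mu>[OF i0, of 0] by simp
  then have em: "ereal \<in> borel_measurable ?\<mu>"
    by (simp cong: measurable_cong_sets)
  have AEC: "AE x in ?\<mu>. \<bar>x\<bar> \<le> C"
    unfolding \<mu>[OF i0, of 0] using i0 C by (subst AE_distr_iff) (auto intro!: borel_measurable_payoff)
  have up: "AE x in ?\<mu>. ereal x \<le> esssup ?\<mu> ereal" by (rule esssup_AE)
  have "esssup ?\<mu> ereal \<le> ereal C"
    using AEC by (intro esssup_I em) auto
  moreover have "ereal (- C) \<le> esssup ?\<mu> ereal"
  proof -
    \<comment> \<open>The inequality does not involve \<open>x\<close>, so in a probability space it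
      suffices to prove it almost everywhere, where some \<open>x\<close> lies between the two
      sides.\<close>
    have "AE x in ?\<mu>. ereal (- C) \<le> esssup ?\<mu> ereal"
      using up AEC
    proof eventually_elim
      case (elim x)
      then have "ereal (- C) \<le> ereal x" by auto
      then show ?case using elim(1) by (rule order.trans)
    qed
    then show ?thesis by simp
  qed
  ultimately obtain M where M: "esssup ?\<mu> ereal = ereal M"
    by (cases "esssup ?\<mu> ereal") auto
  show thesis
  proof
    show "payoff_esssup P I g = ereal M" using M by (simp add: payoff_esssup_def)
    show "AE \<omega> in P. g \<omega> y i \<le> M" if "i \<in> I" for y i
    proof -
      have "AE x in ?\<mu>. x \<le> M" using up by (simp add: M)
      then show ?thesis
        unfolding \<mu>[OF that, of y] using that by (subst (asm) AE_distr_iff) (auto intro!: borel_measurable_payoff)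
    qed
    show "\<mu>.prob {c<..} > 0" if "c < M" for c
    proof -
      have "emeasure ?\<mu> {x\<in>space ?\<mu>. ereal c < ereal x} > 0"
        by (rule esssup_pos_measure[OF em]) (use that M in auto)
      moreover have "{x\<in>space ?\<mu>. ereal c < ereal x} = {c<..}"
        using sets_eq_imp_space_eq[OF sets] by auto
      ultimately show ?thesis by (simp add: \<mu>.emeasure_eq_measure)
    qed
  qed
qed

lemma prob_payoffs_Int:
  assumes "finite J" "J \<subseteq> UNIV \<times> I" "B \<in> sets borel"
  shows "prob {\<omega>\<in>space P. \<forall>(y, i)\<in>J. g \<omega> y i \<in> B} = measure (payoff_law P I g) B ^ card J"
\<comment> \<open>An intersection over an empty index set is \<open>UNIV\<close> rather than
  \<open>space P\<close>, so the product formula is applied to nonempty \<open>J\<close>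
  only.\<close>
proof (cases "J = {}")
  case True
  then show ?thesis by (simp add: prob_space)
next
  case False
  have "{\<omega>\<in>space P. \<forall>(y, i)\<in>J. g \<omega> y i \<in> B}
    = (\<Inter>e\<in>J. (\<lambda>\<omega>. case e of (y, i) \<Rightarrow> g \<omega> y i) -` B \<inter> space P)"
    using False by auto
  also have "prob \<dots> = (\<Prod>e\<in>J. prob ((\<lambda>\<omega>. case e of (y, i) \<Rightarrow> g \<omega> y i) -` B \<inter> space P))"
    using indep_varsD[OF indep_payoffs, of J "\<lambda>_. B"] False assms by (simp add: case_prod_unfold)
  also have "\<dots> = (\<Prod>e\<in>J. measure (payoff_law P I g) B)"
  proof (rule prod.cong[OF refl])
    fix e assume "e \<in> J"
    then obtain y i where e: "e = (y, i)" "i \<in> I" using assms by auto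
    then show "prob ((\<lambda>\<omega>. case e of (y, i) \<Rightarrow> g \<omega> y i) -` B \<inter> space P) = measure (payoff_law P I g) B"
      using prob_payoff_eq[OF e(2) assms(3), of y]
      by (auto simp: vimage_def Int_def conj_commute)
  qed
  finally show ?thesis by simp
qed

text \<open>Translates of \<open>J\<close> along \<open>v\<close> with sufficiently large gaps are
  disjoint, so the events that all their payoffs lie in \<open>B\<close> are independent, with a
  common probability \<open>p > 0\<close>. The probability that the first \<open>N + 1\<close> of
  them all fail is \<open>(1 - p) ^ Suc N\<close>, which tends to 0.\<close>

lemma AE_ex_good_translate:
  fixes J :: "((int ^ 'd) \<times> (int ^ 'd)) set"
  assumes J: "finite J" "J \<subseteq> UNIV \<times> I" and B: "B \<in> sets borel" "measure (payoff_law P I g) B > 0"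
    and v: "v \<noteq> 0"
  shows "AE \<omega> in P. \<exists>K. \<forall>(y, i)\<in>J. g \<omega> (z + of_nat K * v + y) i \<in> B"
proof -
  obtain \<kappa> where \<kappa>: "v $ \<kappa> \<noteq> 0" using v by (auto simp: vec_eq_iff)
  \<comment> \<open>Two states of \<open>J\<close> differ by at most \<open>2 * b\<close> in
    coordinate \<open>\<kappa>\<close>, whereas distinct shifts by multiples of
    \<open>L = 2 * b + 1\<close> along \<open>v\<close> differ there by at least
    \<open>L\<close>.\<close>
  define b where "b = (\<Sum>e\<in>J. \<bar>fst e $ \<kappa>\<bar>)"
  have b: "\<bar>y $ \<kappa>\<bar> \<le> b" if "(y, i) \<in> J" for y i
    unfolding b_def using member_le_sum[of "(y, i)" J "\<lambda>e. \<bar>fst e $ \<kappa>\<bar>"] that J(1) by auto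
  define L where "L = nat (2 * b + 1)"
  define T where "T j = (\<lambda>(y, i). (z + of_nat (j * L) * v + y, i)) ` J" for j
  have b0: "b \<ge> 0" unfolding b_def by (intro sum_nonneg) auto
  have L: "int L = 2 * b + 1" using b0 by (simp add: L_def)
  have finT: "finite (T j)" and subT: "T j \<subseteq> UNIV \<times> I" for j using J by (auto simp: T_def)
  have cardT: "card (T j) = card J" for j
    unfolding T_def by (rule card_image) (auto simp: inj_on_def)
  have disj: "disjoint_family T"
    unfolding disjoint_family_on_def
  proof (intro ballI impI, rule ccontr)
    fix j j' assume jj: "j \<noteq> j'" and "T j \<inter> T j' \<noteq> {}"
    then obtain y y' i where yy: "(y, i) \<in> J" "(y', i) \<in> J"
      "z + of_nat (j * L) * v + y = z + of_nat (j' * L) * v + y'"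
      by (auto simp: T_def)
    then have "(z + of_nat (j * L) * v + y) $ \<kappa> = (z + of_nat (j' * L) * v + y') $ \<kappa>"
      by (intro arg_cong[where f = "\<lambda>u. u $ \<kappa>"])
    then have "(int j - int j') * int L * v $ \<kappa> = y' $ \<kappa> - y $ \<kappa>"
      by (simp add: of_nat_index algebra_simps)
    then have "\<bar>int j - int j'\<bar> * int L * \<bar>v $ \<kappa>\<bar> \<le> 2 * b"
      using b[OF yy(1)] b[OF yy(2)] by (simp add: abs_mult[symmetric])
    moreover have "1 * int L * 1 \<le> \<bar>int j - int j'\<bar> * int L * \<bar>v $ \<kappa>\<bar>"
      using jj \<kappa> by (intro mult_mono) auto
    ultimately show False using L by linarith
  qed
  define p where "p = measure (payoff_law P I g) B ^ card J"
  have p: "p > 0" using B(2) by (simp add: p_def)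
  define A where "A j = {\<omega>\<in>space P. \<forall>(y, i)\<in>T j. g \<omega> y i \<in> B}" for j
  have A [measurable]: "A j \<in> events" for j
  proof -
    have "A j = {\<omega>\<in>space P. \<forall>e\<in>T j. g \<omega> (fst e) (snd e) \<in> B}" by (auto simp: A_def)
    also have "\<dots> \<in> events"
      using finT[of j] subT[of j] B(1)
      by (intro sets.sets_Collect_finite_All) (auto intro!: measurable_sets_Collect[OF borel_measurable_payoff])
    finally show ?thesis .
  qed
  have probA: "prob (A j) = p" for j
    unfolding A_def p_def using prob_payoffs_Int[OF finT subT B(1), of j] by (simp add: cardT)
  let ?X = "\<lambda>e \<omega>. case e of (y, i) \<Rightarrow> g \<omega> y i"
  \<comment> \<open>Payoffs grouped into disjoint blocks are independent as blocks. The events are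
    then taken as failures, since their intersection is the one to be estimated.\<close>
  have "indep_vars (\<lambda>j. PiM (T j) (\<lambda>_. borel)) (\<lambda>j \<omega>. restrict (\<lambda>e. ?X e \<omega>) (T j)) UNIV"
    by (rule indep_vars_restrict[OF _ subT disj]) (use indep_payoffs in \<open>simp add: case_prod_unfold\<close>)
  then have "indep_events (\<lambda>j. {\<omega>\<in>space P. \<not> (\<forall>e\<in>T j. restrict (\<lambda>e. ?X e \<omega>) (T j) e \<in> B)}) UNIV"
  proof (rule indep_eventsI_indep_vars)
    fix j
    show "{x \<in> space (PiM (T j) (\<lambda>_. borel)). \<not> (\<forall>e\<in>T j. x e \<in> B)} \<in> sets (PiM (T j) (\<lambda>_. borel))"
      using finT[of j] B(1)
      by (intro sets.sets_Collect_neg sets.sets_Collect_finite_All)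
         (auto intro!: measurable_sets_Collect[OF measurable_component_singleton])
  qed
  also have "(\<lambda>j. {\<omega>\<in>space P. \<not> (\<forall>e\<in>T j. restrict (\<lambda>e. ?X e \<omega>) (T j) e \<in> B)}) = (\<lambda>j. space P - A j)"
    by (auto simp: A_def fun_eq_iff case_prod_unfold)
  finally have ind: "indep_events (\<lambda>j. space P - A j) UNIV" .
  have fin: "prob (\<Inter>j\<in>{..N}. space P - A j) = (1 - p) ^ Suc N" for N
  proof -
    have "prob (\<Inter>j\<in>{..N}. space P - A j) = (\<Prod>j\<in>{..N}. prob (space P - A j))"
      using ind by (auto simp: indep_events_def)
    then show ?thesis by (simp add: prob_compl probA)
  qed
  have "prob (\<Inter>j. space P - A j) = 0"
  proof (rule antisym)
    have "p \<le> 1" using probA[of 0] prob_le_1[of "A 0"] by simp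
    then have "(\<lambda>N. (1 - p) ^ Suc N) \<longlonglongrightarrow> 0"
      using p by (intro LIMSEQ_Suc LIMSEQ_power_zero) auto
    moreover have "prob (\<Inter>j. space P - A j) \<le> (1 - p) ^ Suc N" for N
      unfolding fin[symmetric] by (intro finite_measure_mono) auto
    ultimately show "prob (\<Inter>j. space P - A j) \<le> 0"
      by (intro LIMSEQ_le_const) auto
  qed simp
  then have "AE \<omega> in P. \<omega> \<notin> (\<Inter>j. space P - A j)"
    by (subst prob_eq_0[symmetric]) auto
  then show ?thesis
    using AE_space
  proof eventually_elim
    case (elim \<omega>)
    then obtain j where "\<omega> \<in> A j" by auto
    then have "\<forall>(y, i)\<in>J. g \<omega> (z + of_nat (j * L) * v + y) i \<in> B"
      by (auto simp: A_def T_def)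
    then show ?case by blast
  qed
qed

text \<open>Above, no payoff exceeds \<open>M\<close> almost surely. Below, repeating a nonzero
  action \<open>v\<close> leads to a translate of the closed walk on which every payoff exceeds a
  threshold close to \<open>M\<close>, and circulating there secures that threshold.\<close>

lemma controllable_limit:
  assumes ctr: "controllable I" and M: "payoff_esssup P I g = ereal M"
  shows "AE \<omega> in P. (\<lambda>n. total_value I (g \<omega>) n z / n) \<longlonglongrightarrow> M"
proof -
  obtain C where C: "C > 0" "\<And>\<omega> y i. \<omega> \<in> space P \<Longrightarrow> i \<in> I \<Longrightarrow> \<bar>g \<omega> y i\<bar> \<le> C"
    by (rule payoff_bound) blast
  have up: "AE \<omega> in P. g \<omega> y i \<le> M" if "i \<in> I" for y i
    using that M by (metis payoff_esssup_real ereal.inject)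
  have pos: "measure (payoff_law P I g) {c<..} > 0" if "c < M" for c
    using that M by (metis payoff_esssup_real ereal.inject)
  obtain v where v: "v \<in> I" "v \<noteq> 0"
    using ctr nonempty_actions by (auto simp: controllable_def)
  obtain xs where xs: "set xs \<subseteq> I" "xs \<noteq> []" "sum_list xs = 0"
    using closed_walk_exists[OF finite_actions] ctr by (auto simp: controllable_def)
  \<comment> \<open>The state-action pairs used by one round of the closed walk started at
    0.\<close>
  define J where "J = (\<lambda>k. (sum_list (take k xs), xs ! k)) ` {..<length xs}"
  have J: "finite J" "J \<subseteq> UNIV \<times> I" using xs(1) by (auto simp: J_def)
  have "AE \<omega> in P. \<forall>y. \<forall>i\<in>I. g \<omega> y i \<le> M"
    using up finite_actions by (intro AE_all_countable[THEN iffD2] allI AE_ball_countable[THEN iffD2])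
      (auto intro: countable_finite)
  \<comment> \<open>Countably many thresholds approaching \<open>M\<close> keep the exceptional set
    null.\<close>
  moreover have "AE \<omega> in P. \<forall>m::nat. \<exists>K. \<forall>(y, i)\<in>J. g \<omega> (z + of_nat K * v + y) i \<in> {M - 1 / (m + 1)<..}"
    using v J by (intro AE_all_countable[THEN iffD2] allI AE_ex_good_translate pos) auto
  ultimately show ?thesis
    using AE_space
  proof eventually_elim
    case (elim \<omega>)
    show ?case
    proof (rule order_tendstoI)
      fix c assume "c < M"
      then obtain m :: nat where m: "inverse (real (Suc m)) < M - c"
        using reals_Archimedean[of "M - c"] by auto
      define c0 where "c0 = M - 1 / (real m + 1)"
      have c0: "c < c0" using m by (simp add: c0_def inverse_eq_divide add.commute)
      obtain K where K: "\<forall>(y, i)\<in>J. c0 < g \<omega> (z + of_nat K * v + y) i"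
        using elim(2) unfolding c0_def greaterThan_iff by blast
      define G where "G = (\<lambda>k. z + of_nat K * v + sum_list (take k xs)) ` {..<length xs}"
      have "real n * c0 \<le> total_value I (g \<omega>) n (z + of_nat K * v)" for n
      proof (rule total_value_ge_trap[OF finite_actions nonempty_actions])
        show "z + of_nat K * v \<in> G"
          unfolding G_def using xs(2) by (intro image_eqI[of _ _ 0]) auto
        fix y assume "y \<in> G"
        then obtain k where k: "k < length xs" "y = z + of_nat K * v + sum_list (take k xs)"
          by (auto simp: G_def)
        have "y + xs ! k \<in> G"
        proof (cases "Suc k < length xs")
          case True
          then show ?thesis
            unfolding G_def k(2) using k(1)
            by (intro image_eqI[of _ _ "Suc k"]) (auto simp: take_Suc_conv_app_nth add.assoc)
        next
          case False
          \<comment> \<open>The last action of the round leads back to its first vertex, because the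
            steps sum to 0.\<close>
          then have "sum_list xs = sum_list (take (Suc k) xs)" by simp
          also have "\<dots> = sum_list (take k xs) + xs ! k"
            unfolding take_Suc_conv_app_nth[OF k(1)] by simp
          finally have "sum_list (take k xs) + xs ! k = 0" using xs(3) by simp
          then show ?thesis
            unfolding G_def k(2) using xs(2,3) by (intro image_eqI[of _ _ 0]) (auto simp: add.assoc)
        qed
        moreover have "c0 \<le> g \<omega> y (xs ! k)"
          using K k by (auto simp: J_def intro!: less_imp_le)
        ultimately show "\<exists>i\<in>I. c0 \<le> g \<omega> y i \<and> y + i \<in> G"
          using k(1) xs(1) by (intro bexI[of _ "xs ! k"]) auto
      qed
      then show "\<forall>\<^sub>F n in sequentially. c < total_value I (g \<omega>) n z / n"
        using C(2)[OF elim(3)] c0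
        by (intro eventually_total_value_gt[OF finite_actions v(1), of C "g \<omega>" c0 z K]) (auto simp: abs_le_iff minus_le_iff)
    next
      fix c assume "M < c"
      show "\<forall>\<^sub>F n in sequentially. total_value I (g \<omega>) n z / n < c"
        using eventually_gt_at_top[of 0]
      proof eventually_elim
        case (elim n)
        have "total_value I (g \<omega>) n z \<le> real n * M"
          using \<open>\<forall>y. \<forall>i\<in>I. g \<omega> y i \<le> M\<close>
          by (intro total_value_upper[OF finite_actions nonempty_actions]) auto
        then have "total_value I (g \<omega>) n z / n \<le> M" using elim by (simp add: field_simps)
        then show ?case using \<open>M < c\<close> by simp
      qed
    qed
  qed
qed

end

section \<open>The oriented case\<close>

definition lattice_box :: "int ^ 'd \<Rightarrow> nat \<Rightarrow> (int ^ 'd) set" where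
  "lattice_box z r = {y. \<forall>k. \<bar>y $ k - z $ k\<bar> \<le> int r}"

text \<open>Polynomial growth in \<open>r\<close> is what makes a union bound over reachable states
  affordable against stretched exponential tails.\<close>

lemma
  fixes z :: "int ^ 'd"
  shows finite_lattice_box: "finite (lattice_box z r)"
    and card_lattice_box_le: "card (lattice_box z r) \<le> (2 * r + 1) ^ CARD('d)"
proof -
  let ?S = "PiE UNIV (\<lambda>k. {z $ k - int r..z $ k + int r})"
  have fin: "finite ?S" by (intro finite_PiE) auto
  have sub: "vec_nth ` lattice_box z r \<subseteq> ?S"
    by (auto simp: lattice_box_def abs_le_iff algebra_simps)
  have inj: "inj_on vec_nth (lattice_box z r)"
    by (auto simp: inj_on_def vec_eq_iff)
  show "finite (lattice_box z r)"
    using finite_imageD[OF finite_subset[OF sub fin] inj] .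
  have "card (lattice_box z r) \<le> card ?S"
    using card_inj_on_le[OF inj sub fin] .
  also have "\<dots> = (2 * r + 1) ^ CARD('d)"
    by (simp add: card_PiE) (simp add: nat_add_distrib nat_mult_distrib)
  finally show "card (lattice_box z r) \<le> (2 * r + 1) ^ CARD('d)" .
qed

lemma centre_in_lattice_box [simp]: "z \<in> lattice_box z r"
  by (simp add: lattice_box_def)

lemma lattice_box_step:
  assumes "\<And>k. \<bar>i $ k\<bar> \<le> int R" "y \<in> lattice_box (z + i) (R * n)"
  shows "y \<in> lattice_box z (R * Suc n)"
  unfolding lattice_box_def
proof (intro CollectI allI)
  fix k
  have "\<bar>y $ k - (z + i) $ k\<bar> \<le> int (R * n)" using assms(2) by (simp add: lattice_box_def)
  with assms(1)[of k] show "\<bar>y $ k - z $ k\<bar> \<le> int (R * Suc n)" by (simp add: algebra_simps)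
qed

context
  fixes I :: "(int ^ 'd) set" and R :: nat
  assumes fin: "finite I" "I \<noteq> {}" and R: "\<And>i k. i \<in> I \<Longrightarrow> \<bar>i $ k\<bar> \<le> int R"
begin

text \<open>A play of \<open>n\<close> stages with steps of size at most \<open>R\<close> stays in
  this box, so the total value is a function of finitely many payoffs.\<close>

lemma total_value_cong_box:
  assumes "\<And>y i. i \<in> I \<Longrightarrow> y \<in> lattice_box z (R * n) \<Longrightarrow> x y i = x' y i"
  shows "total_value I x n z = total_value I x' n z"
  using assms
proof (induction n arbitrary: z)
  case (Suc n)
  have "x z i + total_value I x n (z + i) = x' z i + total_value I x' n (z + i)" if i: "i \<in> I" for i
    using Suc.prems[OF i, of z] Suc.IH[of "z + i"] Suc.prems lattice_box_step[OF R[OF i]] by auto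
  then show ?case
    unfolding total_value.simps by (intro arg_cong[where f = Max] image_cong) auto
qed simp

text \<open>After \<open>m\<close> stages the play is still in the box of radius
  \<open>R * m\<close>, and from there the last \<open>n\<close> stages add at most
  \<open>u\<close>.\<close>

lemma total_value_add_le:
  assumes "\<And>y. y \<in> lattice_box z (R * m) \<Longrightarrow> total_value I x n y \<le> u"
  shows "total_value I x (m + n) z \<le> total_value I x m z + u"
  using assms
proof (induction m arbitrary: z)
  case (Suc m)
  show ?case
    unfolding add_Suc
  proof (rule total_value_le[OF fin])
    fix i assume i: "i \<in> I"
    have "total_value I x (m + n) (z + i) \<le> total_value I x m (z + i) + u"
      using Suc.prems lattice_box_step[OF R[OF i]] by (intro Suc.IH) blast
    then show "x z i + total_value I x (m + n) (z + i) \<le> total_value I x (Suc m) z + u"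
      using total_value_step_le[OF fin i, of x z m] by linarith
  qed
qed simp

text \<open>An optimal play of \<open>m\<close> stages is continued optimally for \<open>n\<close>
  stages from wherever it ends.\<close>

lemma total_value_add_ge:
  assumes "\<And>y. y \<in> lattice_box z (R * m) \<Longrightarrow> u \<le> total_value I x n y"
  shows "total_value I x m z + u \<le> total_value I x (m + n) z"
  using assms
proof (induction m arbitrary: z)
  case (Suc m)
  obtain i where i: "i \<in> I" "total_value I x (Suc m) z = x z i + total_value I x m (z + i)"
    by (rule total_value_attained[OF fin])
  have "total_value I x m (z + i) + u \<le> total_value I x (m + n) (z + i)"
    using Suc.prems lattice_box_step[OF R[OF i(1)]] by (intro Suc.IH) blast
  then show ?case
    using total_value_step_le[OF fin i(1), of x z "m + n"] i(2) by simp
qed simp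

end

text \<open>A hyperplane separates 0 from the compact set \<open>conv I\<close>, so some
  \<open>a\<close> has inner product above \<open>b > 0\<close> with every action. Divided by
  \<open>b\<close>, this functional grows by more than 1 per step, so its floor increases strictly.
  It is linear, so it takes only linearly many integer parts on a box.\<close>

lemma oriented_layers:
  fixes I :: "(int ^ 'd) set"
  assumes fin: "finite I" and or: "0 \<notin> conv I"
  obtains lay :: "int ^ 'd \<Rightarrow> int" and A :: nat
  where "\<And>y i. i \<in> I \<Longrightarrow> lay y < lay (y + i)"
    "\<And>r. card (lay ` lattice_box 0 r) \<le> A * (r + 1)"
proof -
  define f :: "int ^ 'd \<Rightarrow> real ^ 'd" where "f i = (\<chi> k. real_of_int (i $ k))" for i
  have f_add: "f (y + i) = f y + f i" for y i by (simp add: f_def vec_eq_iff)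
  have "convex (conv I)" "closed (conv I)"
    unfolding conv_def using fin
    by (simp_all add: compact_imp_closed compact_convex_hull finite_imp_compact)
  from separating_hyperplane_closed_0[OF this or]
  obtain a b where b: "b > 0" and ab: "\<And>x. x \<in> conv I \<Longrightarrow> a \<bullet> x > b" by blast
  define lay where "lay y = \<lfloor>(a \<bullet> f y) / b\<rfloor>" for y
  define \<Lambda> where "\<Lambda> = nat \<lceil>(\<Sum>k\<in>UNIV. \<bar>a $ k\<bar>) / b\<rceil>"
  show thesis
  proof
    fix y i assume "i \<in> I"
    then have "f i \<in> conv I" unfolding conv_def f_def by (intro hull_inc) auto
    then have "(a \<bullet> f i) / b > 1" using ab[of "f i"] b by simp
    then have "(a \<bullet> f y) / b + 1 \<le> (a \<bullet> f (y + i)) / b"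
      by (simp add: f_add inner_add_right add_divide_distrib)
    then show "lay y < lay (y + i)" unfolding lay_def by linarith
  next
    fix r
    \<comment> \<open>The functional is at most \<open>\<Lambda> * r\<close> in absolute value on
      the box; the additional 1 absorbs the floor.\<close>
    have "lay ` lattice_box 0 r \<subseteq> {- int (\<Lambda> * r + 1)..int (\<Lambda> * r + 1)}"
    proof
      fix t assume "t \<in> lay ` lattice_box 0 r"
      then obtain y where y: "y \<in> lattice_box 0 r" "t = lay y" by auto
      have "\<bar>a \<bullet> f y\<bar> \<le> (\<Sum>k\<in>UNIV. \<bar>a $ k\<bar> * r)"
        unfolding inner_vec_def
      proof (rule order.trans[OF sum_abs sum_mono])
        fix k :: 'd
        have "\<bar>y $ k\<bar> \<le> int r" using y(1) by (simp add: lattice_box_def)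
        then have "\<bar>real_of_int (y $ k)\<bar> \<le> real r" by linarith
        then show "\<bar>a $ k \<bullet> f y $ k\<bar> \<le> \<bar>a $ k\<bar> * r"
          by (simp add: f_def abs_mult mult_left_mono)
      qed
      also have "\<dots> = (\<Sum>k\<in>UNIV. \<bar>a $ k\<bar>) * r" by (simp add: sum_distrib_right)
      finally have "\<bar>(a \<bullet> f y) / b\<bar> \<le> ((\<Sum>k\<in>UNIV. \<bar>a $ k\<bar>) / b) * r"
        using b by (simp add: divide_right_mono)
      also have "\<dots> \<le> real \<Lambda> * r"
        unfolding \<Lambda>_def by (intro mult_right_mono) (auto intro: real_nat_ceiling_ge)
      finally have "\<bar>(a \<bullet> f y) / b\<bar> \<le> real (\<Lambda> * r)" by simp
      moreover have "- int m - 1 \<le> \<lfloor>v\<rfloor> \<and> \<lfloor>v\<rfloor> \<le> int m + 1" if "\<bar>v\<bar> \<le> real m" for v :: real and m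
        using that by linarith
      ultimately show "t \<in> {- int (\<Lambda> * r + 1)..int (\<Lambda> * r + 1)}"
        unfolding y(2) lay_def by fastforce
    qed
    from card_mono[OF _ this] have "card (lay ` lattice_box 0 r) \<le> 2 * (\<Lambda> * r + 1) + 1"
      by (simp add: nat_add_distrib nat_mult_distrib)
    also have "\<dots> \<le> (2 * \<Lambda> + 3) * (r + 1)" by (simp add: algebra_simps)
    finally show "card (lay ` lattice_box 0 r) \<le> (2 * \<Lambda> + 3) * (r + 1)" .
  qed
qed

text \<open>Doubling makes \<open>w (2\<^sup>k n) / (2\<^sup>k n)\<close> uniformly close to \<open>w n / n\<close>; comparing both \<open>2\<^sup>k n\<close> and
  \<open>2\<^sup>k m\<close> with \<open>2\<^sup>k n m\<close> for \<open>k\<close> tending to infinity then gives the Cauchy property.\<close>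

lemma nearly_additive_imp_convergent:
  fixes w :: "nat \<Rightarrow> real"
  assumes w: "\<And>j. j \<ge> 1 \<Longrightarrow>
    \<forall>\<^sub>F n in sequentially. \<bar>w ((j + 1) * n) - w (j * n) - w n\<bar> \<le> 3 * real ((j + 1) * n) powr (3/4)"
  shows "convergent (\<lambda>n. w n / n)"
proof -
  define a where "a n = w n / n" for n
  \<comment> \<open>One doubling of \<open>n\<close> multiplies the error
    \<open>n powr (-1/4)\<close> by \<open>q\<close>; since \<open>q < 1\<close>, the errors of
    repeated doublings are summable.\<close>
  define q :: real where "q = 2 powr (-1/4)"
  have q: "0 < q" "q < 1" unfolding q_def by (auto intro: powr_less_one)
  obtain N0 where N0: "\<And>n. n \<ge> N0 \<Longrightarrow> \<bar>w (2 * n) - w n - w n\<bar> \<le> 3 * real (2 * n) powr (3/4)"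
    using w[of 1] by (auto simp: eventually_sequentially numeral_2_eq_2)
  \<comment> \<open>The sum of the geometric series of the doubling errors
    \<open>3 * q * q ^ l\<close>.\<close>
  define D where "D = 3 * q / (1 - q)"
  have dbl: "\<bar>a (2 * n) - a n\<bar> \<le> 3 * q * real n powr (-1/4)" if "n \<ge> N0" "n \<ge> 1" for n
  proof -
    have "a (2 * n) - a n = (w (2 * n) - w n - w n) / (2 * n)"
      using that by (simp add: a_def field_simps)
    then have "\<bar>a (2 * n) - a n\<bar> \<le> 3 * real (2 * n) powr (3/4) / (2 * n)"
      using N0[OF that(1)] by (simp add: divide_right_mono)
    also have "\<dots> = 3 * (real (2 * n) powr (3/4) / real (2 * n) powr 1)"
      using that by simp
    also have "\<dots> = 3 * real (2 * n) powr (-1/4)"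
      by (subst powr_diff[symmetric]) simp
    also have "\<dots> = 3 * q * real n powr (-1/4)"
      by (simp add: q_def powr_mult)
    finally show ?thesis .
  qed
  have pow: "\<bar>a (2 ^ k * n) - a n\<bar> \<le> D * real n powr (-1/4)" if n: "n \<ge> N0" "n \<ge> 1" for k n
  proof -
    have "\<bar>a (2 ^ k * n) - a n\<bar> \<le> (\<Sum>l<k. 3 * q * real n powr (-1/4) * q ^ l)"
    proof (induction k)
      case (Suc k)
      have m: "n \<le> 2 ^ k * n" by simp
      have "\<bar>a (2 * (2 ^ k * n)) - a (2 ^ k * n)\<bar> \<le> 3 * q * real (2 ^ k * n) powr (-1/4)"
        using n m by (intro dbl) linarith+
      also have "real (2 ^ k * n) powr (-1/4) = q ^ k * real n powr (-1/4)"
        by (simp add: powr_mult q_def powr_power powr_realpow[symmetric] powr_powr mult.commute)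
      finally show ?case using Suc by (simp add: mult_ac)
    qed simp
    also have "\<dots> = 3 * q * real n powr (-1/4) * (\<Sum>l<k. q ^ l)" by (simp add: sum_distrib_left)
    also have "\<dots> \<le> 3 * q * real n powr (-1/4) * (1 / (1 - q))"
    proof (intro mult_left_mono)
      show "(\<Sum>l<k. q ^ l) \<le> 1 / (1 - q)"
        using q by (subst sum_gp_strict) (auto intro!: divide_right_mono)
    qed (use q in auto)
    finally show ?thesis by (simp add: D_def)
  qed
  have mult: "(\<lambda>n. a (j * n) - a n) \<longlonglongrightarrow> 0" if "j \<ge> 1" for j
  proof -
    \<comment> \<open>For fixed \<open>j\<close>, adding up \<open>j - 1\<close> near-additivity
      errors, each of order \<open>n powr (3/4)\<close>, still gives \<open>o(n)\<close>.\<close>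
    have "(\<lambda>n. w (j * n) / n - j * (w n / n)) \<longlonglongrightarrow> 0"
      using that
    proof (induction j rule: nat_induct_at_least)
      case base
      then show ?case by simp
    next
      case (Suc j)
      have "(\<lambda>n. (w ((j + 1) * n) - w (j * n) - w n) / n) \<longlonglongrightarrow> 0"
      proof (rule Lim_null_comparison)
        show "\<forall>\<^sub>F n in sequentially. norm ((w ((j + 1) * n) - w (j * n) - w n) / n)
            \<le> 3 * ((real j + 1) * real n) powr (3/4) / real n"
          using w[OF Suc.hyps]
          by eventually_elim (simp add: divide_right_mono distrib_right add.commute)
        have "real j + 1 > 0" by simp
        then show "(\<lambda>n. 3 * ((real j + 1) * real n) powr (3/4) / real n) \<longlonglongrightarrow> 0"
          by real_asymp
      qed
      from tendsto_add_zero[OF this Suc.IH] show ?case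
        by (rule Lim_transform_eventually) (auto intro!: always_eventually simp: diff_divide_distrib add_divide_distrib algebra_simps)
    qed
    then have "(\<lambda>n. (w (j * n) / n - j * (w n / n)) / j) \<longlonglongrightarrow> 0 / j"
      by (intro tendsto_divide) (use that in auto)
    then show ?thesis
      using that by (simp add: a_def diff_divide_distrib mult.commute)
  qed
  have close: "\<bar>a n - a m\<bar> \<le> D * real n powr (-1/4) + D * real m powr (-1/4)"
    if nm: "n \<ge> N0" "n \<ge> 1" "m \<ge> N0" "m \<ge> 1" for n m
  proof (rule LIMSEQ_le_const)
    \<comment> \<open>This allows \<open>mult\<close>, a limit in \<open>n\<close>, to be used along
      the doubling subsequences.\<close>
    have sub: "filterlim (\<lambda>k. 2 ^ k * l) sequentially sequentially" if "l \<ge> 1" for l :: nat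
    proof (rule filterlim_at_top_mono[OF filterlim_ident], rule always_eventually, rule allI)
      fix k :: nat
      have "k \<le> 2 ^ k" by (rule less_imp_le) simp
      also have "\<dots> \<le> 2 ^ k * l" using that by simp
      finally show "k \<le> 2 ^ k * l" .
    qed
    have "(\<lambda>k. a (m * (2 ^ k * n)) - a (2 ^ k * n)) \<longlonglongrightarrow> 0" "(\<lambda>k. a (n * (2 ^ k * m)) - a (2 ^ k * m)) \<longlonglongrightarrow> 0"
      using filterlim_compose[OF mult sub] nm by auto
    then have "(\<lambda>k. D * real n powr (-1/4) + D * real m powr (-1/4)
        + (\<bar>a (m * (2 ^ k * n)) - a (2 ^ k * n)\<bar> + \<bar>a (n * (2 ^ k * m)) - a (2 ^ k * m)\<bar>))
      \<longlonglongrightarrow> D * real n powr (-1/4) + D * real m powr (-1/4) + (\<bar>0\<bar> + \<bar>0\<bar>)"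
      by (intro tendsto_intros)
    then show "(\<lambda>k. D * real n powr (-1/4) + D * real m powr (-1/4)
        + (\<bar>a (m * (2 ^ k * n)) - a (2 ^ k * n)\<bar> + \<bar>a (n * (2 ^ k * m)) - a (2 ^ k * m)\<bar>))
      \<longlonglongrightarrow> D * real n powr (-1/4) + D * real m powr (-1/4)"
      by simp
    have "m * (2 ^ k * n) = n * (2 ^ k * m)" for k by simp
    then have "\<bar>a n - a m\<bar> \<le> D * real n powr (-1/4) + D * real m powr (-1/4)
        + (\<bar>a (m * (2 ^ k * n)) - a (2 ^ k * n)\<bar> + \<bar>a (n * (2 ^ k * m)) - a (2 ^ k * m)\<bar>)" for k
      using pow[OF nm(1,2), of k] pow[OF nm(3,4), of k] by (smt (verit))
    then show "\<exists>N. \<forall>k\<ge>N. \<bar>a n - a m\<bar> \<le> D * real n powr (-1/4) + D * real m powr (-1/4)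
        + (\<bar>a (m * (2 ^ k * n)) - a (2 ^ k * n)\<bar> + \<bar>a (n * (2 ^ k * m)) - a (2 ^ k * m)\<bar>)"
      by blast
  qed
  have "Cauchy a"
  proof (rule metric_CauchyI)
    fix e :: real assume "e > 0"
    have "(\<lambda>n. D * real n powr (-1/4)) \<longlonglongrightarrow> 0"
      by real_asymp
    then have "\<forall>\<^sub>F n in sequentially. D * real n powr (-1/4) < e / 2"
      using \<open>e > 0\<close> by (intro order_tendstoD) auto
    then obtain N1 where N1: "\<And>n. n \<ge> N1 \<Longrightarrow> D * real n powr (-1/4) < e / 2"
      by (auto simp: eventually_sequentially)
    show "\<exists>M. \<forall>m\<ge>M. \<forall>n\<ge>M. dist (a m) (a n) < e"
    proof (intro exI allI impI)
      fix m n assume "max (max N0 N1) 1 \<le> m" "max (max N0 N1) 1 \<le> n"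
      then show "dist (a m) (a n) < e"
        using close[of m n] N1[of m] N1[of n] by (simp add: dist_real_def)
    qed
  qed
  then show ?thesis by (simp add: Cauchy_convergent_iff a_def[abs_def])
qed

section \<open>Concentration, means and the almost sure limit in the oriented case\<close>

context PMDP begin

text \<open>The payoffs in a finite window have the same product law wherever the window is placed.
  This transfers estimates from the product space to \<open>P\<close>, uniformly in the initial
  state \<open>z\<close>.\<close>

lemma distr_translated_payoffs:
  fixes J :: "((int ^ 'd) \<times> (int ^ 'd)) set"
  assumes J: "finite J" "J \<subseteq> UNIV \<times> I"
  shows "distr P (PiM J (\<lambda>_. payoff_law P I g)) (\<lambda>\<omega>. \<lambda>(y, i)\<in>J. g \<omega> (y + z) i)
    = PiM J (\<lambda>_. payoff_law P I g)"
    and "(\<lambda>\<omega>. \<lambda>(y, i)\<in>J. g \<omega> (y + z) i) \<in> P \<rightarrow>\<^sub>M PiM J (\<lambda>_. payoff_law P I g)"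
proof -
  let ?\<mu> = "payoff_law P I g" and ?X = "\<lambda>\<omega>. \<lambda>(y, i)\<in>J. g \<omega> (y + z) i"
  obtain i0 where i0: "i0 \<in> I" using nonempty_actions by blast
  interpret \<mu>: prob_space ?\<mu>
    unfolding payoff_law_eq[OF i0, of 0] by (intro prob_space_distr borel_measurable_payoff i0)
  interpret prod: product_prob_space "\<lambda>_::(int ^ 'd) \<times> (int ^ 'd). ?\<mu>" UNIV
    by (rule product_prob_spaceI) (rule \<mu>.prob_space_axioms)
  have sets: "sets ?\<mu> = sets borel" using payoff_law_eq[OF i0, of 0] by simp
  show meas: "?X \<in> P \<rightarrow>\<^sub>M PiM J (\<lambda>_. ?\<mu>)"
  proof (rule measurable_restrict)
    fix e assume "e \<in> J"
    then show "(\<lambda>\<omega>. case e of (y, i) \<Rightarrow> g \<omega> (y + z) i) \<in> P \<rightarrow>\<^sub>M ?\<mu>"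
      using J(2) borel_measurable_payoff by (auto simp: measurable_cong_sets[OF refl sets])
  qed
  show "distr P (PiM J (\<lambda>_. ?\<mu>)) ?X = PiM J (\<lambda>_. ?\<mu>)"
  proof (rule prod.PiM_eqI[OF J(1)])
    fix A :: "(int ^ 'd) \<times> (int ^ 'd) \<Rightarrow> real set"
    assume A: "\<And>e. e \<in> J \<Longrightarrow> A e \<in> sets ?\<mu>"
    show "emeasure (distr P (PiM J (\<lambda>_. ?\<mu>)) ?X) (PiE J A) = (\<Prod>e\<in>J. emeasure ?\<mu> (A e))"
    proof (cases "J = {}")
      case True
      have "PiE J A \<in> sets (PiM J (\<lambda>_. ?\<mu>))" by (simp add: True sets_PiM_empty)
      moreover have "?X -` PiE J A \<inter> space P = space P" by (auto simp: True)
      ultimately show ?thesis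
        using emeasure_distr[OF meas, of "PiE J A"] by (simp add: True emeasure_space_1)
    next
      case False
      \<comment> \<open>\<open>\<tau>\<close> moves the window to its actual position and
        \<open>A'\<close> moves the sides of the rectangle with it, so that independence applies to
        the original family of payoffs.\<close>
      define \<tau> where "\<tau> e = (fst e + z, snd e)" for e :: "(int ^ 'd) \<times> (int ^ 'd)"
      define A' where "A' e = A (fst e - z, snd e)" for e :: "(int ^ 'd) \<times> (int ^ 'd)"
      let ?Y = "\<lambda>e \<omega>. case e of (y, i) \<Rightarrow> g \<omega> y i"
      have inj: "inj_on \<tau> J" by (auto simp: inj_on_def \<tau>_def prod_eq_iff)
      have A\<tau>: "A' (\<tau> e) = A e" for e by (simp add: A'_def \<tau>_def)
      have \<tau>J: "\<tau> ` J \<subseteq> UNIV \<times> I" using J(2) by (auto simp: \<tau>_def)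
      have "?X -` PiE J A \<inter> space P = (\<Inter>e\<in>\<tau> ` J. ?Y e -` A' e \<inter> space P)"
        using False by (auto simp: PiE_def Pi_def A\<tau> \<tau>_def A'_def case_prod_unfold)
      then have "emeasure (distr P (PiM J (\<lambda>_. ?\<mu>)) ?X) (PiE J A) = prob (\<Inter>e\<in>\<tau> ` J. ?Y e -` A' e \<inter> space P)"
        using meas A J(1) by (subst emeasure_distr) (auto simp: emeasure_eq_measure intro!: sets_PiM_I_finite)
      also have "prob (\<Inter>e\<in>\<tau> ` J. ?Y e -` A' e \<inter> space P) = (\<Prod>e\<in>\<tau> ` J. prob (?Y e -` A' e \<inter> space P))"
        using False J(1) \<tau>J A
        by (intro indep_varsD[where I = "UNIV \<times> I" and M' = "\<lambda>_. borel"])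
           (auto simp: A\<tau> sets indep_payoffs[unfolded case_prod_unfold] case_prod_unfold)
      also have "\<dots> = (\<Prod>e\<in>J. prob (?Y (\<tau> e) -` A e \<inter> space P))"
        by (simp add: prod.reindex[OF inj] A\<tau>)
      also have "\<dots> = (\<Prod>e\<in>J. \<mu>.prob (A e))"
      proof (rule prod.cong[OF refl])
        fix e assume e: "e \<in> J"
        then have i: "snd e \<in> I" using J(2) by auto
        show "prob (?Y (\<tau> e) -` A e \<inter> space P) = \<mu>.prob (A e)"
          using prob_payoff_eq[OF i A[OF e, unfolded sets], of "fst e + z"]
          by (auto simp: \<tau>_def vimage_def Int_def conj_commute)
      qed
      also have "ennreal (\<Prod>e\<in>J. \<mu>.prob (A e)) = (\<Prod>e\<in>J. emeasure ?\<mu> (A e))"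
        by (simp add: \<mu>.emeasure_eq_measure prod_ennreal)
      finally show ?thesis .
    qed
  qed simp
qed

lemma action_bound:
  obtains R :: nat where "\<And>i k. i \<in> I \<Longrightarrow> \<bar>i $ k\<bar> \<le> int R"
proof
  fix i k assume i: "i \<in> I"
  have "\<bar>i $ k\<bar> \<le> (\<Sum>k\<in>UNIV. \<bar>i $ k\<bar>)" by (rule member_le_sum) auto
  also have "\<dots> \<le> (\<Sum>i\<in>I. \<Sum>k\<in>UNIV. \<bar>i $ k\<bar>)"
    using i finite_actions by (intro member_le_sum) (auto intro: sum_nonneg)
  also have "\<dots> = int (nat (\<Sum>i\<in>I. \<Sum>k\<in>UNIV. \<bar>i $ k\<bar>))"
    by (simp add: sum_nonneg)
  finally show "\<bar>i $ k\<bar> \<le> int (nat (\<Sum>i\<in>I. \<Sum>k\<in>UNIV. \<bar>i $ k\<bar>))" .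
qed

lemma borel_measurable_total_value_payoff [measurable]:
  "(\<lambda>\<omega>. total_value I (g \<omega>) n z) \<in> borel_measurable P"
  by (intro borel_measurable_total_value[OF finite_actions nonempty_actions] borel_measurable_payoff)

text \<open>The initial state 0 stands for all states, since by translation invariance the law of
  the total value does not depend on the initial state.\<close>

definition mean_value :: "nat \<Rightarrow> real" where
  "mean_value n = expectation (\<lambda>\<omega>. total_value I (g \<omega>) n 0)"

text \<open>Within \<open>n\<close> stages there are \<open>O(n)\<close> layers, each moving the
  total value by at most \<open>2 * C\<close>. For deviations of size
  \<open>t = n powr (3/4)\<close> the bounded differences exponent is of order
  \<open>t\<^sup>2 / n = sqrt n\<close>.\<close>

lemma oriented_concentration:
  assumes or: "0 \<notin> conv I"
  obtains \<kappa> where "\<kappa> > 0" "\<And>n z. n \<ge> 1 \<Longrightarrow>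
    prob {\<omega>\<in>space P. \<bar>total_value I (g \<omega>) n z - mean_value n\<bar> \<ge> n powr (3/4)} \<le> 2 * exp (- \<kappa> * sqrt n)"
proof -
  obtain lay :: "int ^ 'd \<Rightarrow> int" and A :: nat
    where lay: "\<And>y i. i \<in> I \<Longrightarrow> lay y < lay (y + i)"
      and cardlay: "\<And>r. card (lay ` lattice_box 0 r) \<le> A * (r + 1)"
    using oriented_layers[OF finite_actions or] by blast
  obtain R where R: "\<And>i k. i \<in> I \<Longrightarrow> \<bar>i $ k\<bar> \<le> int R" by (rule action_bound) blast
  obtain C where C: "C > 0" "\<And>\<omega> y i. \<omega> \<in> space P \<Longrightarrow> i \<in> I \<Longrightarrow> \<bar>g \<omega> y i\<bar> \<le> C"
    by (rule payoff_bound) blast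
  let ?\<mu> = "payoff_law P I g"
  obtain i0 where i0: "i0 \<in> I" using nonempty_actions by blast
  have \<mu>: "prob_space ?\<mu>"
    unfolding payoff_law_eq[OF i0, of 0] by (intro prob_space_distr borel_measurable_payoff i0)
  have sets: "sets ?\<mu> = sets borel" using payoff_law_eq[OF i0, of 0] by simp
  \<comment> \<open>Obtained by inserting \<open>card K \<le> A * (R + 1) * n\<close>, oscillation
    \<open>2 * C\<close> and squared deviation \<open>n * sqrt n\<close> into the tail
    bound.\<close>
  define \<kappa> where "\<kappa> = 2 / ((2 * C)\<^sup>2 * (A * (R + 1)))"
  have A0: "A > 0"
  proof (rule ccontr)
    assume "\<not> A > 0"
    then have "lay ` lattice_box 0 0 = {}"
      using cardlay[of 0] finite_lattice_box[of "0 :: int ^ 'd" 0] by simp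
    then show False using centre_in_lattice_box[of "0 :: int ^ 'd" 0] by blast
  qed
  have \<kappa>0: "\<kappa> > 0" unfolding \<kappa>_def using A0 C(1) by (intro divide_pos_pos mult_pos_pos) (simp_all add: add_pos_nonneg)
  have "prob {\<omega>\<in>space P. \<bar>total_value I (g \<omega>) n z - mean_value n\<bar> \<ge> n powr (3/4)} \<le> 2 * exp (- \<kappa> * sqrt n)"
    if n: "n \<ge> 1" for n z
  proof -
    \<comment> \<open>All state-action pairs that a play of \<open>n\<close> stages from 0 can
      meet.\<close>
    define J where "J = lattice_box (0 :: int ^ 'd) (R * n) \<times> I"
    define N where "N = PiM J (\<lambda>_. ?\<mu>)"
    define K where "K = lay ` lattice_box 0 (R * n)"
    \<comment> \<open>The payoffs in the window around \<open>z\<close>, recentred at 0.\<close>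
    define T where "T z \<omega> = (\<lambda>(y, i)\<in>J. g \<omega> (y + z) i)" for z \<omega>
    (* Payoffs are truncated to [-C, C] because configurations in the product space are bounded only
       almost everywhere. *)
    define ext where "ext x y i = (if (y, i) \<in> J then max (- C) (min C (x (y, i))) else 0)"
      for x :: "(int ^ 'd) \<times> (int ^ 'd) \<Rightarrow> real" and y i
    define f where "f x = total_value I (ext x) n 0" for x
    have J: "finite J" "J \<subseteq> UNIV \<times> I" using finite_actions by (auto simp: J_def finite_lattice_box)
    have Tm: "T z \<in> P \<rightarrow>\<^sub>M N" and TN: "distr P N (T z) = N" for z
      unfolding T_def N_def using distr_translated_payoffs[OF J, of z] by auto
    have fT: "f (T z \<omega>) = total_value I (g \<omega>) n z" if "\<omega> \<in> space P" for z \<omega>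
    proof -
      have "total_value I (g \<omega>) n z = total_value I (\<lambda>u. g \<omega> (u + z)) n 0"
        using total_value_translate[of I "g \<omega>" n 0 z, OF finite_actions nonempty_actions] by simp
      also have "\<dots> = f (T z \<omega>)"
        unfolding f_def
      proof (rule total_value_cong_box[OF finite_actions nonempty_actions R])
        fix y i :: "int ^ 'd" assume "i \<in> I" "y \<in> lattice_box 0 (R * n)"
        then have "(y, i) \<in> J" "\<bar>g \<omega> (y + z) i\<bar> \<le> C"
          using C(2)[OF that] by (simp_all add: J_def)
        then show "g \<omega> (y + z) i = ext (T z \<omega>) y i"
          by (simp add: ext_def T_def)
      qed
      finally show ?thesis by simp
    qed
    have ext_le: "\<bar>ext x y i\<bar> \<le> C" for x y i using C(1) by (auto simp: ext_def)
    have fm: "f \<in> borel_measurable N"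
      unfolding f_def
    proof (rule borel_measurable_total_value[OF finite_actions nonempty_actions])
      fix y i
      show "(\<lambda>x. ext x y i) \<in> borel_measurable N"
      proof (cases "(y, i) \<in> J")
        case True
        then have "(\<lambda>x. x (y, i)) \<in> N \<rightarrow>\<^sub>M ?\<mu>"
          unfolding N_def by (rule measurable_component_singleton)
        then have [measurable]: "(\<lambda>x. x (y, i)) \<in> borel_measurable N"
          by (simp add: measurable_cong_sets[OF refl sets])
        show ?thesis using True by (simp add: ext_def)
      qed (simp add: ext_def)
    qed
    have f_le: "\<bar>f x\<bar> \<le> n * C" for x
      unfolding f_def by (rule total_value_abs_le[OF finite_actions nonempty_actions ext_le])
    \<comment> \<open>Truncated payoffs of two configurations differ by at most
      \<open>2 * C\<close>, and only within layer \<open>k\<close>.\<close>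
    have osc1: "f x \<le> f y + 2 * C" if "\<And>e. e \<in> J \<Longrightarrow> lay (fst e) \<noteq> k \<Longrightarrow> x e = y e" for x y k
      unfolding f_def
    proof (rule total_value_layer_le[OF finite_actions nonempty_actions lay])
      show "ext x u i = ext y u i" if "lay u \<noteq> k" for u i
        using \<open>\<And>e. e \<in> J \<Longrightarrow> lay (fst e) \<noteq> k \<Longrightarrow> x e = y e\<close>[of "(u, i)"] that by (simp add: ext_def)
      show "ext x u i \<le> ext y u i + 2 * C" for u i
        using ext_le[of x u i] ext_le[of y u i] by linarith
    qed (use C(1) in auto)
    have mean: "mean_value n = (\<integral>x. f x \<partial>N)"
    proof -
      have "(\<integral>x. f x \<partial>N) = (\<integral>x. f x \<partial>distr P N (T 0))" by (simp add: TN)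
      also have "\<dots> = expectation (\<lambda>\<omega>. f (T 0 \<omega>))" by (rule integral_distr[OF Tm fm])
      also have "\<dots> = mean_value n"
        unfolding mean_value_def by (intro Bochner_Integration.integral_cong) (auto simp: fT)
      finally show ?thesis by simp
    qed
    let ?t = "real n powr (3/4)"
    have K: "finite K" "K \<noteq> {}"
      using centre_in_lattice_box[of "0 :: int ^ 'd" "R * n"] unfolding K_def
      by (simp_all only: finite_lattice_box finite_imageI image_is_empty) blast
    define S where "S = {x\<in>space N. ?t \<le> \<bar>f x - (\<integral>x. f x \<partial>N)\<bar>}"
    have "S \<in> sets N"
      unfolding S_def by (intro borel_measurable_le borel_measurable_abs borel_measurable_diff borel_measurable_const fm)
    then have "measure (distr P N (T z)) S = prob (T z -` S \<inter> space P)"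
      by (rule measure_distr[OF Tm])
    moreover have "{\<omega>\<in>space P. ?t \<le> \<bar>total_value I (g \<omega>) n z - mean_value n\<bar>} = T z -` S \<inter> space P"
      unfolding mean S_def using measurable_space[OF Tm[of z]] by (auto simp add: fT)
    ultimately have "prob {\<omega>\<in>space P. ?t \<le> \<bar>total_value I (g \<omega>) n z - mean_value n\<bar>} = measure N S"
      by (simp only: TN)
    also have "\<dots> \<le> 2 * exp (- 2 * ?t\<^sup>2 / ((2 * C)\<^sup>2 * card K))"
      unfolding S_def N_def
    proof (rule bounded_differences_tail[where lay = "\<lambda>e. lay (fst e)" and K = K and b = "n * C", OF \<mu> K J(1)])
      show "(\<lambda>e. lay (fst e)) ` J \<subseteq> K" by (auto simp: J_def K_def)
      show "f \<in> borel_measurable (PiM J (\<lambda>_. ?\<mu>))" using fm by (simp add: N_def)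
      fix k and x y :: "(int ^ 'd) \<times> (int ^ 'd) \<Rightarrow> real"
      assume ag: "\<And>e. e \<in> J \<Longrightarrow> lay (fst e) \<noteq> k \<Longrightarrow> x e = y e"
      have "f x \<le> f y + 2 * C" "f y \<le> f x + 2 * C"
        by (rule osc1[of k]; use ag in auto)+
      then show "\<bar>f x - f y\<bar> \<le> 2 * C" by simp
    qed (use C(1) n f_le in auto)
    also have "\<dots> \<le> 2 * exp (- \<kappa> * sqrt n)"
    proof -
      have t2: "?t\<^sup>2 = real n * sqrt n"
        using n by (simp add: powr_half_sqrt[symmetric] powr_power powr_mult_base)
      have cK: "real (card K) \<le> A * (R + 1) * n"
      proof -
        have "card K \<le> A * (R * n + 1)" unfolding K_def by (rule cardlay)
        also have "\<dots> \<le> A * ((R + 1) * n)" using n by (intro mult_left_mono) auto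
        finally have "real (card K) \<le> real (A * ((R + 1) * n))" by (rule of_nat_mono)
        then show ?thesis by (simp add: algebra_simps)
      qed
      have cK0: "real (card K) > 0" using K by (simp add: card_gt_0_iff)
      have "\<kappa> * sqrt n = 2 * (real n * sqrt n) / ((2 * C)\<^sup>2 * (A * (R + 1) * n))"
        using n by (simp add: \<kappa>_def)
      also have "\<dots> \<le> 2 * (real n * sqrt n) / ((2 * C)\<^sup>2 * card K)"
        using cK cK0 C(1) by (intro divide_left_mono mult_left_mono mult_pos_pos) auto
      finally have "- 2 * (real n * sqrt n) / ((2 * C)\<^sup>2 * card K) \<le> - \<kappa> * sqrt n"
        by simp
      then show ?thesis unfolding t2 by simp
    qed
    finally show ?thesis .
  qed
  with \<kappa>0 show thesis by (rule that)
qed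

text \<open>A deterministic statement obtained from a single sample point: if the exceptional events
  have total probability below 1, some \<open>\<omega>\<close> has all the relevant values close to
  their means, and the additivity bounds for the values at that \<open>\<omega>\<close> become
  bounds for the means.\<close>

lemma oriented_mean_value_nearly_additive:
  assumes or: "0 \<notin> conv I" and j: "j \<ge> 1"
  shows "\<forall>\<^sub>F n in sequentially. \<bar>mean_value ((j + 1) * n) - mean_value (j * n) - mean_value n\<bar>
    \<le> 3 * real ((j + 1) * n) powr (3/4)"
proof -
  obtain \<kappa> where \<kappa>: "\<kappa> > 0" "\<And>n z. n \<ge> 1 \<Longrightarrow>
    prob {\<omega>\<in>space P. \<bar>total_value I (g \<omega>) n z - mean_value n\<bar> \<ge> n powr (3/4)} \<le> 2 * exp (- \<kappa> * sqrt n)"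
    using oriented_concentration[OF or] by blast
  obtain R where R: "\<And>i k. i \<in> I \<Longrightarrow> \<bar>i $ k\<bar> \<le> int R" by (rule action_bound) blast
  define E where "E m z = {\<omega>\<in>space P. \<bar>total_value I (g \<omega>) m z - mean_value m\<bar> \<ge> m powr (3/4)}" for m z
  have E [measurable]: "E m z \<in> events" for m z unfolding E_def by measurable
  define d where "d = CARD('d)"
  \<comment> \<open>Chosen so that \<open>(a * n) ^ d\<close> bounds the number of states in the box
    of radius \<open>R * (j * n)\<close> when \<open>n \<ge> 1\<close>.\<close>
  define a where "a = real (2 * R * j + 1)"
  have a: "a > 0" by (simp add: a_def add_pos_nonneg)
  \<comment> \<open>The first term pays for the two long horizons from 0, the second for horizon
    \<open>n\<close> from every state of the box.\<close>
  have "(\<lambda>n. 4 * exp (- \<kappa> * sqrt n) + a ^ d * (2 * (real n powr d * exp (- \<kappa> * sqrt n)))) \<longlonglongrightarrow> 0"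
    using \<kappa>(1) by real_asymp
  then have "\<forall>\<^sub>F n in sequentially. 4 * exp (- \<kappa> * sqrt n) + a ^ d * (2 * (real n powr d * exp (- \<kappa> * sqrt n))) < 1"
    by (rule order_tendstoD) simp
  then show ?thesis
    using eventually_ge_at_top[of 1]
  proof eventually_elim
    case (elim n)
    define B :: "(int ^ 'd) set" where "B = lattice_box 0 (R * (j * n))"
    have finB: "finite B" by (simp add: B_def finite_lattice_box)
    have cardB: "real (card B) \<le> (a * n) ^ d"
    proof -
      have "card B \<le> (2 * (R * (j * n)) + 1) ^ d" unfolding B_def d_def by (rule card_lattice_box_le)
      also have "\<dots> \<le> ((2 * R * j + 1) * n) ^ d"
        using elim(2) by (intro power_mono) auto
      finally have "real (card B) \<le> real (((2 * R * j + 1) * n) ^ d)" by (rule of_nat_mono)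
      then show ?thesis by (simp only: a_def of_nat_power of_nat_mult)
    qed
    have ex: "exp (- \<kappa> * sqrt (l * n)) \<le> exp (- \<kappa> * sqrt n)" if "l \<ge> 1" for l :: nat
      using \<kappa>(1) that elim(2) by simp
    have pE: "prob (E (l * n) z) \<le> 2 * exp (- \<kappa> * sqrt n)" if "l \<ge> 1" for l z
    proof -
      have "prob (E (l * n) z) \<le> 2 * exp (- \<kappa> * sqrt (l * n))"
        unfolding E_def using that elim(2) by (intro \<kappa>(2)) auto
      also have "\<dots> \<le> 2 * exp (- \<kappa> * sqrt n)"
        using ex[OF that] by (intro mult_left_mono) auto
      finally show ?thesis .
    qed
    \<comment> \<open>The state reached after \<open>j * n\<close> stages is not known in advance,
      so the last \<open>n\<close> stages must be controlled from every state of
      \<open>B\<close>.\<close>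
    define Bad where "Bad = E ((j + 1) * n) 0 \<union> (E (j * n) 0 \<union> (\<Union>y\<in>B. E n y))"
    have "prob Bad \<le> prob (E ((j + 1) * n) 0) + (prob (E (j * n) 0) + (\<Sum>y\<in>B. prob (E n y)))"
      unfolding Bad_def using finB
      by (intro order.trans[OF measure_Un_le] add_mono order_refl measure_UNION_le)
         (auto intro!: sets.finite_UN)
    also have "\<dots> \<le> 2 * exp (- \<kappa> * sqrt n) + (2 * exp (- \<kappa> * sqrt n) + (\<Sum>y\<in>B. 2 * exp (- \<kappa> * sqrt n)))"
      using pE[of "j + 1"] pE[OF j] pE[of 1] by (intro add_mono sum_mono) auto
    also have "\<dots> = 4 * exp (- \<kappa> * sqrt n) + card B * (2 * exp (- \<kappa> * sqrt n))" by simp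
    also have "\<dots> \<le> 4 * exp (- \<kappa> * sqrt n) + (a * n) ^ d * (2 * exp (- \<kappa> * sqrt n))"
      using cardB by (intro add_left_mono mult_right_mono) auto
    also have "\<dots> = 4 * exp (- \<kappa> * sqrt n) + a ^ d * (2 * (real n powr d * exp (- \<kappa> * sqrt n)))"
      using elim(2) by (simp add: power_mult_distrib powr_realpow)
    also have "\<dots> < 1" by (rule elim(1))
    finally have "prob Bad < 1" .
    then have "Bad \<noteq> space P" using prob_space by auto
    moreover have "Bad \<subseteq> space P" by (auto simp: Bad_def E_def)
    ultimately obtain \<omega> where \<omega>: "\<omega> \<in> space P" "\<omega> \<notin> Bad" by blast
    define W where "W = total_value I (g \<omega>)"
    define t where "t m = real m powr (3/4)" for m :: nat
    have 1: "\<bar>W ((j + 1) * n) 0 - mean_value ((j + 1) * n)\<bar> < t ((j + 1) * n)"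
      and 2: "\<bar>W (j * n) 0 - mean_value (j * n)\<bar> < t (j * n)"
      and 3: "\<And>y. y \<in> B \<Longrightarrow> \<bar>W n y - mean_value n\<bar> < t n"
      using \<omega> by (auto simp: Bad_def E_def W_def t_def not_le)
    have mono: "t (j * n) \<le> t ((j + 1) * n)" "t n \<le> t ((j + 1) * n)"
      unfolding t_def by (intro powr_mono2; simp)+
    have eq: "(j + 1) * n = j * n + n" by simp
    have "W ((j + 1) * n) 0 \<le> W (j * n) 0 + (mean_value n + t n)"
      unfolding W_def eq
    proof (rule total_value_add_le[OF finite_actions nonempty_actions R])
      fix y :: "int ^ 'd" assume "y \<in> lattice_box 0 (R * (j * n))"
      then show "total_value I (g \<omega>) n y \<le> mean_value n + t n"
        using 3[of y] by (simp add: B_def W_def abs_less_iff)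
    qed
    moreover have "W (j * n) 0 + (mean_value n - t n) \<le> W ((j + 1) * n) 0"
      unfolding W_def eq
    proof (rule total_value_add_ge[OF finite_actions nonempty_actions R])
      fix y :: "int ^ 'd" assume "y \<in> lattice_box 0 (R * (j * n))"
      then show "mean_value n - t n \<le> total_value I (g \<omega>) n y"
        using 3[of y] by (simp add: B_def W_def abs_less_iff)
    qed
    \<comment> \<open>Each of the three values contributes one error, and all three errors are at
      most \<open>t ((j + 1) * n)\<close>.\<close>
    ultimately have "\<bar>mean_value ((j + 1) * n) - mean_value (j * n) - mean_value n\<bar> \<le> 3 * t ((j + 1) * n)"
      using 1 2 mono unfolding abs_le_iff abs_less_iff by linarith
    then show ?case by (simp add: t_def)
  qed
qed

text \<open>The tail probabilities are summable and deviations of size \<open>n powr (3/4)\<close>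
  are \<open>o(n)\<close>, so by Borel-Cantelli the values follow the means. The means refer to
  state 0 only, hence one \<open>L\<close> serves every \<open>z\<close>.\<close>

lemma oriented_limit:
  assumes or: "0 \<notin> conv I"
  obtains L where "\<And>z. AE \<omega> in P. (\<lambda>n. total_value I (g \<omega>) n z / n) \<longlonglongrightarrow> L"
proof -
  obtain \<kappa> where \<kappa>: "\<kappa> > 0" "\<And>n z. n \<ge> 1 \<Longrightarrow>
    prob {\<omega>\<in>space P. \<bar>total_value I (g \<omega>) n z - mean_value n\<bar> \<ge> n powr (3/4)} \<le> 2 * exp (- \<kappa> * sqrt n)"
    using oriented_concentration[OF or] by blast
  have "convergent (\<lambda>n. mean_value n / n)"
    by (rule nearly_additive_imp_convergent) (rule oriented_mean_value_nearly_additive[OF or])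
  then obtain L where L: "(\<lambda>n. mean_value n / n) \<longlonglongrightarrow> L" by (auto simp: convergent_def)
  have "AE \<omega> in P. (\<lambda>n. total_value I (g \<omega>) n z / n) \<longlonglongrightarrow> L" for z
  proof -
    define E where "E n = {\<omega>\<in>space P. \<bar>total_value I (g \<omega>) n z - mean_value n\<bar> \<ge> n powr (3/4)}" for n
    have "summable (\<lambda>n. prob (E n))"
    proof (rule summable_comparison_test_ev)
      have "\<forall>\<^sub>F n in sequentially. 2 * exp (- \<kappa> * sqrt n) \<le> 1 / real n ^ 2"
        using \<kappa>(1) by real_asymp
      then show "\<forall>\<^sub>F n in sequentially. norm (prob (E n)) \<le> 1 / real n ^ 2"
        using eventually_ge_at_top[of 1]
      proof eventually_elim
        case (elim n)
        have "prob (E n) \<le> 2 * exp (- \<kappa> * sqrt n)"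
          unfolding E_def by (rule \<kappa>(2)[OF elim(2)])
        then show ?case using elim(1) by simp
      qed
      show "summable (\<lambda>n. 1 / real n ^ 2)"
        using inverse_power_summable[of 2, where ?'a = real] by (simp add: inverse_eq_divide)
    qed
    then have "AE \<omega> in P. \<forall>\<^sub>F n in sequentially. \<omega> \<in> space P - E n"
      by (intro borel_cantelli_AE1) (auto simp: E_def emeasure_eq_measure)
    then show ?thesis
    proof eventually_elim
      case (elim \<omega>)
      have "(\<lambda>n. total_value I (g \<omega>) n z / n - mean_value n / n) \<longlonglongrightarrow> 0"
      proof (rule Lim_null_comparison)
        show "\<forall>\<^sub>F n in sequentially. norm (total_value I (g \<omega>) n z / n - mean_value n / n) \<le> real n powr (3/4) / n"
          using elim
          by eventually_elim (simp add: E_def not_le diff_divide_distrib[symmetric] divide_right_mono less_imp_le)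
        show "(\<lambda>n. real n powr (3/4) / real n) \<longlonglongrightarrow> 0" by real_asymp
      qed
      from tendsto_add[OF this L] show ?case by simp
    qed
  qed
  then show thesis by (rule that)
qed

end

section \<open>Convergence of the stage values in the trivial, controllable and oriented
  cases\<close>

theorem theorem2p9:
  fixes P :: "'w measure"
    and I :: "(int ^ 'd) set"
    and g :: "'w \<Rightarrow> int ^ 'd \<Rightarrow> int ^ 'd \<Rightarrow> real"
    and z :: "int ^ 'd"
  assumes "PMDP P I g"
  shows "\<exists>v_inf :: 'w \<Rightarrow> real. v_inf \<in> borel_measurable P
    \<and> (AE \<omega> in P. (\<lambda>n. stage_value P I g n z \<omega>) \<longlonglongrightarrow> v_inf \<omega>)
    \<and> (I = {0} \<longrightarrow> (AE \<omega> in P. v_inf \<omega> = g \<omega> z 0))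
    \<and> (controllable I \<longrightarrow> (AE \<omega> in P. ereal (v_inf \<omega>) = payoff_esssup P I g))"
proof -
  interpret PMDP P I g by fact
  have lim: "AE \<omega> in P. (\<lambda>n. stage_value P I g n z \<omega>) \<longlonglongrightarrow> L"
    if "AE \<omega> in P. (\<lambda>n. total_value I (g \<omega>) n z / n) \<longlonglongrightarrow> L" for L
    using that AE_space by eventually_elim (simp add: stage_value_eq)
  consider "I = {0}" | "controllable I" | "I \<noteq> {0}" "0 \<notin> conv I"
    by (auto simp: controllable_def)
  then show ?thesis
  proof cases
    case 1
    \<comment> \<open>The only action is 0, so the play never leaves \<open>z\<close> and collects
      the same payoff at every stage.\<close>
    have tv: "total_value I (g \<omega>) n z = n * g \<omega> z 0" for \<omega> n
      by (induction n) (simp_all add: total_value.simps 1 algebra_simps)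
    have "AE \<omega> in P. (\<lambda>n. stage_value P I g n z \<omega>) \<longlonglongrightarrow> g \<omega> z 0"
    proof (rule AE_I2)
      fix \<omega> assume \<omega>: "\<omega> \<in> space P"
      \<comment> \<open>Equality is claimed only for \<open>n > 0\<close>, since division by zero
        makes the value at \<open>n = 0\<close> equal to 0.\<close>
      have "\<forall>\<^sub>F n in sequentially. g \<omega> z 0 = stage_value P I g n z \<omega>"
        by (intro eventually_mono[OF eventually_gt_at_top[of 0]]) (simp add: stage_value_eq[OF \<omega>] tv)
      then show "(\<lambda>n. stage_value P I g n z \<omega>) \<longlonglongrightarrow> g \<omega> z 0"
        by (rule Lim_transform_eventually[OF tendsto_const])
    qed
    moreover have "\<not> controllable I" using 1 by (simp add: controllable_def)
    ultimately show ?thesis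
      using borel_measurable_payoff[of 0 z] 1 by (intro exI[of _ "\<lambda>\<omega>. g \<omega> z 0"]) auto
  next
    case 2
    obtain M where M: "payoff_esssup P I g = ereal M"
      by (rule payoff_esssup_real) (rule that)
    have "I \<noteq> {0}" using 2 by (simp add: controllable_def)
    then show ?thesis
      using lim[OF controllable_limit[OF 2 M]] M by (intro exI[of _ "\<lambda>_. M"]) auto
  next
    case 3
    obtain L where "\<And>z. AE \<omega> in P. (\<lambda>n. total_value I (g \<omega>) n z / n) \<longlonglongrightarrow> L"
      by (rule oriented_limit[OF 3(2)]) blast
    moreover have "\<not> controllable I" using 3 by (simp add: controllable_def)
    ultimately show ?thesis
      using lim 3(1) by (intro exI[of _ "\<lambda>_. L"]) auto
  qed
qed

end
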